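(* Let $m\ge 6$ be an integer and let $n=3m+2$ or $n=3m$. If $\mathcal F\subset 2^{[n]}$ is partition-free, then $$|\mathcal F|\le \sum_{t=m+1}^{2m+1}\binom{n}{t}.$$ Moreover, for $n=3m+2$ equality is possible (up to a permutation of the ground set) only when $\mathcal F=\mathcal K(3m+2)$ or $\mathcal F=\mathcal K(3m+1)^d$. For $n=3m$ equality is possible only when $\mathcal F=\mathcal K(3m)$ or $\mathcal F=\tilde{\mathcal K}_x(3m)$ for some $x\in[n]$.
   Context: $[n]=\{1,\dots,n\}$ and $2^{[n]}$ is its power set. A family $\mathcal F\subset 2^{[n]}$ is partition-free if there are no $F_0,F_1,F_2\in\mathcal F$ with $F_1\cap F_2=\emptyset$ and $F_0=F_1\cup F_2$. For $n=3m+l$ with $0\le l\le 2$, $\mathcal K(n):=\{K\subset[n]: m+1\le |K|\le 2m+1\}$. For a family $\mathcal G\subset 2^{[n]}$, its double is $\mathcal G^d:=\{F\subset[n+1]: F\cap[n]\in\mathcal G\}\subset 2^{[n+1]}$; thus $\mathcal K(3m+1)^d\subset 2^{[3m+2]}$. For $n=3m$ and $x\in[n]$, $\tilde{\mathcal K}_x(3m):=\{F\subset[n]: |F|=m,\ x\in F\}\cup\big(\mathcal K(3m)\setminus\{G\subset[n]: |G|=2m+1,\ x\in G\}\big)$. *)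

theory Defs
  imports Main "HOL-Combinatorics.Permutations"
begin

text \<open>The three members need not be distinct; in particular a partition-free family cannot
  contain the empty set, since \<open>{} = {} \<union> {}\<close>.\<close>
definition partition_free :: "nat set set \<Rightarrow> bool" where
  "partition_free \<F> \<longleftrightarrow>
     \<not> (\<exists>F0\<in>\<F>. \<exists>F1\<in>\<F>. \<exists>F2\<in>\<F>. F1 \<inter> F2 = {} \<and> F0 = F1 \<union> F2)"

text \<open>For \<open>n = 3 * m + l\<close> with \<open>l \<le> 2\<close>, the number \<open>n div 3\<close> is \<open>m\<close>.\<close>
definition K_family :: "nat \<Rightarrow> nat set set" where
  "K_family n = {K. K \<subseteq> {1..n} \<and> n div 3 + 1 \<le> card K \<and> card K \<le> 2 * (n div 3) + 1}"

text \<open>The double of a family on the ground set \<open>{1..n}\<close>; it lives on \<open>{1..n + 1}\<close>.\<close>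
definition double_family :: "nat \<Rightarrow> nat set set \<Rightarrow> nat set set" where
  "double_family n \<G> = {F. F \<subseteq> {1..n + 1} \<and> F \<inter> {1..n} \<in> \<G>}"

text \<open>The parameter is \<open>m\<close>; the ground set is \<open>{1..3 * m}\<close>.\<close>
definition K_tilde :: "nat \<Rightarrow> nat \<Rightarrow> nat set set" where
  "K_tilde m x =
     {F. F \<subseteq> {1..3 * m} \<and> card F = m \<and> x \<in> F} \<union>
     (K_family (3 * m) - {G. G \<subseteq> {1..3 * m} \<and> card G = 2 * m + 1 \<and> x \<in> G})"

end

theory Submission
  imports Defs Complex_Main
begin

text \<open>Write \<open>f t\<close> for the proportion of \<open>t\<close>-subsets of \<open>[n]\<close> lying in the family and \<open>y t = 1 - f t\<close>.
  Averaging a valid inequality for a small configuration of sets over all permutations of \<open>[n]\<close>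
  turns it into a linear inequality between these densities. Disjoint sets \<open>A\<close>, \<open>B\<close> give
  \<open>f s + f t + f (s + t) \<le> 2\<close>, which with binomial weights controls all levels far from the
  window \<open>[m + 1, 2m + 1]\<close>. The levels next to the window need a sharper charge.

  For \<open>n = 3m + 2\<close> one averages
  \<open>f (2m+2) + 2 f m \<le> 2 y (m+1) + y (2m+1) + y (2m) + 2 y (m+2)\<close> and
  \<open>f (2m+2) + f (2m+3) \<le> 2 y (m+1) + 2 y (m+2)\<close>. For \<open>n = 3m\<close> one uses arcs in cyclic orderings of
  \<open>(2m + 1)\<close>-sets, which give
  \<open>f m + f (m-1) \<le> m / (2m+1) * y (2m+1) + y (2m) + y (m+1) + y (m+2) + y (2m-1)\<close>.

  Equality makes every level free of slack either full or empty and every critical configuration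
  tight. Tightness says that the \<open>k\<close>-sets in question (the missing \<open>(m + 1)\<close>-sets, respectively the
  present \<open>m\<close>-sets) are pairwise intersecting and that, whenever \<open>E\<close> is one of them,
  \<open>E \<inter> P = {q}\<close> and \<open>u \<notin> E \<union> P\<close>, one of \<open>P\<close> and \<open>E - {q} \<union> {u}\<close> is one of them as well. Such a
  family is empty or a full star.\<close>

section \<open>Densities of levels and averaging over permutations\<close>

text \<open>For \<open>t > n\<close> the binomial coefficient is 0, and division by zero makes the
  density 0 as well.\<close>

definition dens :: "nat \<Rightarrow> nat set set \<Rightarrow> nat \<Rightarrow> real" where
  "dens n \<F> t = card {A \<in> \<F>. card A = t} / (n choose t)"

text \<open>\<open>S\<close> and its image have complements of equal size in \<open>V\<close>, and
  any bijection between these completes \<open>g\<close>. In the equality cases this lays a fixed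
  model configuration onto given sets.\<close>

lemma permutes_extend:
  assumes "finite V" "S \<subseteq> V" "inj_on g S" "g ` S \<subseteq> V"
  obtains \<pi> where "\<pi> permutes V" "\<And>x. x \<in> S \<Longrightarrow> \<pi> x = g x"
proof -
  have "card (V - S) = card (V - g ` S)"
    using assms by (simp add: card_Diff_subset finite_subset card_image)
  then obtain h where h: "bij_betw h (V - S) (V - g ` S)"
    using assms(1) by (metis finite_Diff finite_same_card_bij)
  define \<pi> where "\<pi> x = (if x \<in> S then g x else if x \<in> V then h x else x)" for x
  have 1: "bij_betw \<pi> S (g ` S)"
    using assms(3) by (auto simp: \<pi>_def bij_betw_def inj_on_def)
  have 2: "bij_betw \<pi> (V - S) (V - g ` S)"
    using h by (subst bij_betw_cong[where g = h]) (auto simp: \<pi>_def)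
  have "bij_betw \<pi> (S \<union> (V - S)) (g ` S \<union> (V - g ` S))"
    by (rule bij_betw_combine[OF 1 2]) auto
  then have "bij_betw \<pi> V V"
    using assms(2,4) by (simp add: Un_absorb1)
  then have "\<pi> permutes V"
    by (rule bij_imp_permutes) (use assms(2) in \<open>auto simp: \<pi>_def\<close>)
  then show ?thesis
    by (rule that) (simp add: \<pi>_def)
qed

text \<open>Composing with a permutation that carries \<open>A\<close> to \<open>A'\<close> shows
  that the number of permutations sending \<open>X\<close> onto \<open>A\<close> depends only on the
  size of \<open>A\<close>; these classes split all permutations evenly.\<close>

lemma card_permutes_image:
  assumes V: "finite V" and X: "X \<subseteq> V" and A: "A \<subseteq> V" "card A = card X"
  shows "real (card {\<pi>. \<pi> permutes V \<and> \<pi> ` X = A}) = fact (card V) / (card V choose card X)"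
proof -
  define N where "N A = card {\<pi>. \<pi> permutes V \<and> \<pi> ` X = A}" for A
  have fin: "finite {\<pi>. \<pi> permutes V \<and> Q \<pi>}" for Q
    by (rule finite_subset[OF _ finite_permutations[OF V]]) auto
  \<comment> \<open>One inequality is enough, because \<open>A\<close> and \<open>A'\<close> can be
    swapped.\<close>
  have le: "N A \<le> N A'" if A: "A \<subseteq> V" "card A = card X" and A': "A' \<subseteq> V" "card A' = card X" for A A'
  proof -
    obtain g where g: "bij_betw g A A'"
      using A A' V by (metis finite_subset finite_same_card_bij)
    obtain \<sigma> where \<sigma>: "\<sigma> permutes V" "\<And>x. x \<in> A \<Longrightarrow> \<sigma> x = g x"
      using permutes_extend[OF V A(1), of g] g A' unfolding bij_betw_def by metis
    have im: "\<sigma> ` A = A'"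
      using \<sigma>(2) g by (auto simp: bij_betw_def)
    show ?thesis
      unfolding N_def
    proof (rule card_inj_on_le[where f = "\<lambda>\<pi>. \<sigma> \<circ> \<pi>"])
      show "inj_on ((\<circ>) \<sigma>) {\<pi>. \<pi> permutes V \<and> \<pi> ` X = A}"
        using permutes_inj[OF \<sigma>(1)] by (auto simp: inj_on_def fun_eq_iff)
      show "(\<circ>) \<sigma> ` {\<pi>. \<pi> permutes V \<and> \<pi> ` X = A} \<subseteq> {\<pi>. \<pi> permutes V \<and> \<pi> ` X = A'}"
        using \<sigma>(1) im by (auto simp: permutes_compose image_comp[symmetric])
    qed (rule fin)
  qed
  let ?I = "{A. A \<subseteq> V \<and> card A = card X}"
  have eq: "{\<pi>. \<pi> permutes V} = (\<Union>A\<in>?I. {\<pi>. \<pi> permutes V \<and> \<pi> ` X = A})"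
  proof (intro equalityI subsetI)
    fix \<pi> assume "\<pi> \<in> {\<pi>. \<pi> permutes V}"
    then have "\<pi> ` X \<subseteq> V" "card (\<pi> ` X) = card X" "\<pi> permutes V"
      using image_mono[OF X, of \<pi>] by (auto simp: permutes_image card_image permutes_inj_on)
    then show "\<pi> \<in> (\<Union>A\<in>?I. {\<pi>. \<pi> permutes V \<and> \<pi> ` X = A})"
      by blast
  qed blast
  have "card {\<pi>. \<pi> permutes V} = (\<Sum>A\<in>?I. card {\<pi>. \<pi> permutes V \<and> \<pi> ` X = A})"
    unfolding eq
  proof (rule card_UN_disjoint)
    show "finite ?I" using V by simp
  qed (use fin in auto)
  also have "\<dots> = (\<Sum>B\<in>?I. N A)"
  proof (rule sum.cong)
    fix B assume "B \<in> ?I"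
    then have "N B = N A"
      using A by (intro antisym le) auto
    then show "card {\<pi>. \<pi> permutes V \<and> \<pi> ` X = B} = N A"
      by (simp add: N_def)
  qed simp
  finally have "fact (card V) = (card V choose card X) * N A"
    using V by (simp add: card_permutations[OF refl] n_subsets)
  then have "fact (card V) = real (card V choose card X) * real (N A)"
    by (metis of_nat_fact of_nat_mult)
  moreover have "card V choose card X > 0"
    using V X by (simp add: card_mono)
  ultimately show ?thesis
    by (simp add: N_def field_simps)
qed

section \<open>Families on \<open>{1..n}\<close> and averaging over permutations\<close>

locale family =
  fixes n :: nat and \<F> :: "nat set set"
  assumes sub: "\<F> \<subseteq> Pow {1..n}"
begin

abbreviation f :: "nat \<Rightarrow> real" where "f \<equiv> dens n \<F>"

lemma finite_family: "finite \<F>"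
  using sub by (rule finite_subset) simp

lemma finite_member: "A \<in> \<F> \<Longrightarrow> finite A"
  using sub by (meson PowD finite_atLeastAtMost finite_subset subsetD)

lemma card_level_le: "card {A \<in> \<F>. card A = t} \<le> n choose t"
proof -
  have "card {A \<in> \<F>. card A = t} \<le> card {A. A \<subseteq> {1..n} \<and> card A = t}"
    using sub by (intro card_mono) auto
  then show ?thesis
    by (simp add: n_subsets)
qed

lemma f_nonneg [simp]: "0 \<le> f t"
  by (simp add: dens_def)

lemma f_le_1 [simp]: "f t \<le> 1"
  using card_level_le[of t] by (cases "n choose t = 0") (auto simp: dens_def divide_simps)

lemma level_full: "f t = 1 \<Longrightarrow> A \<subseteq> {1..n} \<Longrightarrow> card A = t \<Longrightarrow> A \<in> \<F>"
proof -
  assume 1: "f t = 1" "A \<subseteq> {1..n}" "card A = t"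
  have "card {A \<in> \<F>. card A = t} = n choose t"
    using 1(1) by (auto simp: dens_def divide_simps split: if_splits)
  then have "card {A \<in> \<F>. card A = t} = card {A. A \<subseteq> {1..n} \<and> card A = t}"
    by (simp add: n_subsets)
  then have "{A \<in> \<F>. card A = t} = {A. A \<subseteq> {1..n} \<and> card A = t}"
    using sub by (intro card_subset_eq) auto
  then show "A \<in> \<F>"
    using 1 by blast
qed

lemma level_empty: "f t = 0 \<Longrightarrow> A \<in> \<F> \<Longrightarrow> card A \<noteq> t"
proof
  assume 1: "f t = 0" "A \<in> \<F>" "card A = t"
  then have "t \<le> n"
    using sub by (metis PowD card_atLeastAtMost card_mono diff_Suc_1 finite_atLeastAtMost subsetD)
  then have "{A \<in> \<F>. card A = t} = {}"
    using 1(1) finite_family by (simp add: dens_def)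
  then show False
    using 1 by blast
qed

lemma card_family: "real (card \<F>) = (\<Sum>t\<le>n. (n choose t) * f t)"
proof -
  have "card A \<le> n" if "A \<in> \<F>" for A
    using sub that by (metis PowD card_atLeastAtMost card_mono diff_Suc_1 finite_atLeastAtMost subsetD)
  then have "\<F> = (\<Union>t\<le>n. {A \<in> \<F>. card A = t})"
    by auto
  then have "card \<F> = (\<Sum>t\<le>n. card {A \<in> \<F>. card A = t})"
    using finite_family by (subst card_UN_disjoint[symmetric]) auto
  then show ?thesis
    by (simp add: dens_def)
qed

text \<open>Sort the permutations by the member onto which they send \<open>X\<close>; every member
  of size \<open>card X\<close> is reached equally often.\<close>

lemma sum_permutes_in:
  assumes X: "X \<subseteq> {1..n}"
  shows "(\<Sum>\<pi> | \<pi> permutes {1..n}. of_bool (\<pi> ` X \<in> \<F>)) = fact n * f (card X)"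
proof -
  let ?P = "{\<pi>. \<pi> permutes {1..n}}"
  have fin: "finite ?P"
    by (simp add: finite_permutations)
  have "?P \<inter> {\<pi>. \<pi> ` X \<in> \<F>} = (\<Union>A\<in>{A \<in> \<F>. card A = card X}. {\<pi>. \<pi> permutes {1..n} \<and> \<pi> ` X = A})"
    by (auto simp: card_image permutes_inj_on)
  then have "card (?P \<inter> {\<pi>. \<pi> ` X \<in> \<F>}) =
      (\<Sum>A\<in>{A \<in> \<F>. card A = card X}. card {\<pi>. \<pi> permutes {1..n} \<and> \<pi> ` X = A})"
    using fin finite_family by (subst card_UN_disjoint[symmetric]) auto
  then have "real (card (?P \<inter> {\<pi>. \<pi> ` X \<in> \<F>})) =
      (\<Sum>A\<in>{A \<in> \<F>. card A = card X}. real (card {\<pi>. \<pi> permutes {1..n} \<and> \<pi> ` X = A}))"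
    by simp
  also have "\<dots> = (\<Sum>A\<in>{A \<in> \<F>. card A = card X}. fact n / (n choose card X))"
    using sub X by (intro sum.cong refl) (subst card_permutes_image, auto)
  finally show ?thesis
    using fin by (simp add: dens_def of_bool_def sum.If_cases Int_def)
qed

lemma sum_average:
  assumes "\<And>c X. (c, X) \<in> set L \<Longrightarrow> X \<subseteq> {1..n}"
  shows "(\<Sum>\<pi> | \<pi> permutes {1..n}. (\<Sum>(c, X)\<leftarrow>L. c * of_bool (\<pi> ` X \<in> \<F>))) =
      fact n * (\<Sum>(c, X)\<leftarrow>L. c * f (card X))"
  using assms
proof (induction L)
  case (Cons p L)
  obtain c X where p: "p = (c, X)" by fastforce
  have X: "X \<subseteq> {1..n}"
    using Cons.prems[of c X] p by simp
  have IH: "(\<Sum>\<pi> | \<pi> permutes {1..n}. (\<Sum>(c, X)\<leftarrow>L. c * of_bool (\<pi> ` X \<in> \<F>))) =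
      fact n * (\<Sum>(c, X)\<leftarrow>L. c * f (card X))"
    using Cons.prems by (intro Cons.IH) (metis list.set_intros(2))
  show ?case
    unfolding p list.map sum_list.Cons prod.case sum.distrib IH
      sum_distrib_left[symmetric] sum_permutes_in[OF X]
    by (simp only: distrib_left mult.left_commute)
qed simp

lemma average_le:
  assumes local: "\<And>\<pi>. \<pi> permutes {1..n} \<Longrightarrow> (\<Sum>(c, X)\<leftarrow>L. c * of_bool (\<pi> ` X \<in> \<F>)) \<le> b"
    and L: "\<And>c X. (c, X) \<in> set L \<Longrightarrow> X \<subseteq> {1..n}"
  shows "(\<Sum>(c, X)\<leftarrow>L. c * f (card X)) \<le> b"
proof -
  have "(\<Sum>\<pi> | \<pi> permutes {1..n}. (\<Sum>(c, X)\<leftarrow>L. c * of_bool (\<pi> ` X \<in> \<F>))) =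
      fact n * (\<Sum>(c, X)\<leftarrow>L. c * f (card X))"
    using L by (rule sum_average)
  moreover have "(\<Sum>\<pi> | \<pi> permutes {1..n}. (\<Sum>(c, X)\<leftarrow>L. c * of_bool (\<pi> ` X \<in> \<F>))) \<le> fact n * b"
    using sum_mono[of "{\<pi>. \<pi> permutes {1..n}}", OF local]
    by (simp add: card_permutations[OF refl])
  ultimately show ?thesis
    by simp
qed

text \<open>Numbers that are at most \<open>b\<close> and average to \<open>b\<close> all equal
  \<open>b\<close>. This turns equality between densities into tightness of the local inequality at
  every copy of the configuration.\<close>

lemma average_eq:
  assumes local: "\<And>\<pi>. \<pi> permutes {1..n} \<Longrightarrow> (\<Sum>(c, X)\<leftarrow>L. c * of_bool (\<pi> ` X \<in> \<F>)) \<le> b"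
    and L: "\<And>c X. (c, X) \<in> set L \<Longrightarrow> X \<subseteq> {1..n}"
    and eq: "(\<Sum>(c, X)\<leftarrow>L. c * f (card X)) = b"
    and \<sigma>: "\<sigma> permutes {1..n}"
  shows "(\<Sum>(c, X)\<leftarrow>L. c * of_bool (\<sigma> ` X \<in> \<F>)) = b"
proof -
  let ?P = "{\<pi>. \<pi> permutes {1..n}}"
  let ?g = "\<lambda>\<pi>. (\<Sum>(c, X)\<leftarrow>L. c * of_bool (\<pi> ` X \<in> \<F>))"
  have "(\<Sum>\<pi>\<in>?P. ?g \<pi>) = fact n * (\<Sum>(c, X)\<leftarrow>L. c * f (card X))"
    using L by (rule sum_average)
  then have "(\<Sum>\<pi>\<in>?P. ?g \<pi>) = (\<Sum>\<pi>\<in>?P. b)"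
    using eq by (simp add: card_permutations[OF refl])
  then show ?thesis
    using sum_mono_inv[of ?g ?P "\<lambda>_. b" \<sigma>] local \<sigma> by (simp add: finite_permutations)
qed

end

section \<open>Local inequalities and their averages\<close>

lemma partition_freeD:
  "partition_free \<F> \<Longrightarrow> A \<in> \<F> \<Longrightarrow> B \<in> \<F> \<Longrightarrow> A \<inter> B = {} \<Longrightarrow> A \<union> B \<notin> \<F>"
  by (auto simp: partition_free_def)

text \<open>An injection preserves unions and disjointness. Local inequalities can thus be proved
  for fixed sets in an arbitrary partition-free family and then applied to all images under
  permutations.\<close>

lemma partition_free_vimage:
  assumes "partition_free \<F>" "inj g"
  shows "partition_free {X. g ` X \<in> \<F>}"
  using assms unfolding partition_free_def
  by (auto simp: image_Un) (metis image_Int image_empty)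

lemma local_pair:
  assumes "partition_free \<G>" "A \<inter> B = {}"
  shows "of_bool (A \<in> \<G>) + of_bool (B \<in> \<G>) + of_bool (A \<union> B \<in> \<G>) \<le> (2 :: real)"
  using partition_freeD[OF assms(1) _ _ assms(2)] by auto

text \<open>There are three forbidden triples: \<open>B\<close> with \<open>C\<close>,
  \<open>B\<close> with \<open>insert a C\<close>, and \<open>insert a B\<close> with
  \<open>C\<close>, each with its union. No set lies in all three, so at least two of the six sets
  are missing.\<close>

lemma local_point:
  assumes pf: "partition_free \<G>" and BC: "B \<inter> C = {}" and a: "a \<notin> B" "a \<notin> C"
  shows "of_bool (B \<union> C \<in> \<G>) + of_bool (insert a (B \<union> C) \<in> \<G>)
    + of_bool (B \<in> \<G>) + of_bool (C \<in> \<G>) + of_bool (insert a B \<in> \<G>) + of_bool (insert a C \<in> \<G>) \<le> (4 :: real)"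
  using partition_freeD[OF pf, of B C] partition_freeD[OF pf, of B "insert a C"]
    partition_freeD[OF pf, of "insert a B" C] BC a
  by (auto simp: of_bool_def)

text \<open>For \<open>X\<close>, \<open>Z\<close> of size \<open>m\<close>, the sets
  \<open>X\<close>, \<open>Z\<close> and the full union of size \<open>2m + 2\<close> lie outside
  the window. The other sets weigh 12 together, so the claim is that each of these three, when
  present, accounts for missing weight 2 among the others. The nine forbidden triples give this in
  each of the eight cases.\<close>

lemma local_two_points:
  assumes pf: "partition_free \<G>" and XZ: "X \<inter> Z = {}" and a: "a \<notin> X" "a \<notin> Z" and b: "b \<notin> X" "b \<notin> Z"
    and ab: "a \<noteq> b"
  shows "2 * of_bool (insert a (insert b (X \<union> Z)) \<in> \<G>) + 2 * of_bool (X \<in> \<G>) + 2 * of_bool (Z \<in> \<G>)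
     + of_bool (insert a X \<in> \<G>) + of_bool (insert b X \<in> \<G>) + of_bool (insert a Z \<in> \<G>) + of_bool (insert b Z \<in> \<G>)
     + of_bool (insert a (X \<union> Z) \<in> \<G>) + of_bool (insert b (X \<union> Z) \<in> \<G>) + 2 * of_bool (X \<union> Z \<in> \<G>)
     + 2 * of_bool (insert a (insert b X) \<in> \<G>) + 2 * of_bool (insert a (insert b Z) \<in> \<G>) \<le> (12 :: real)"
proof -
  have 1: "\<not> (X \<in> \<G> \<and> Z \<in> \<G> \<and> X \<union> Z \<in> \<G>)"
    using partition_freeD[OF pf, of X Z] XZ by auto
  have 2: "\<not> (X \<in> \<G> \<and> insert a Z \<in> \<G> \<and> insert a (X \<union> Z) \<in> \<G>)"
    using partition_freeD[OF pf, of X "insert a Z"] XZ a by auto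
  have 3: "\<not> (X \<in> \<G> \<and> insert b Z \<in> \<G> \<and> insert b (X \<union> Z) \<in> \<G>)"
    using partition_freeD[OF pf, of X "insert b Z"] XZ b by auto
  have 4: "\<not> (insert a X \<in> \<G> \<and> Z \<in> \<G> \<and> insert a (X \<union> Z) \<in> \<G>)"
    using partition_freeD[OF pf, of "insert a X" Z] XZ a by auto
  have 5: "\<not> (insert b X \<in> \<G> \<and> Z \<in> \<G> \<and> insert b (X \<union> Z) \<in> \<G>)"
    using partition_freeD[OF pf, of "insert b X" Z] XZ b by auto
  have 6: "\<not> (insert a X \<in> \<G> \<and> insert b Z \<in> \<G> \<and> insert a (insert b (X \<union> Z)) \<in> \<G>)"
    using partition_freeD[OF pf, of "insert a X" "insert b Z"] XZ a b ab by (auto simp: insert_commute)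
  have 7: "\<not> (insert b X \<in> \<G> \<and> insert a Z \<in> \<G> \<and> insert a (insert b (X \<union> Z)) \<in> \<G>)"
    using partition_freeD[OF pf, of "insert b X" "insert a Z"] XZ a b ab by (auto simp: insert_commute)
  have 8: "\<not> (X \<in> \<G> \<and> insert a (insert b Z) \<in> \<G> \<and> insert a (insert b (X \<union> Z)) \<in> \<G>)"
    using partition_freeD[OF pf, of X "insert a (insert b Z)"] XZ a b by auto
  have 9: "\<not> (insert a (insert b X) \<in> \<G> \<and> Z \<in> \<G> \<and> insert a (insert b (X \<union> Z)) \<in> \<G>)"
    using partition_freeD[OF pf, of "insert a (insert b X)" Z] XZ a b by auto
  show ?thesis
    using 1 2 3 4 5 6 7 8 9
    by (cases "X \<in> \<G>"; cases "Z \<in> \<G>"; cases "insert a (insert b (X \<union> Z)) \<in> \<G>") auto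
qed

section \<open>Averaged inequalities between the level densities\<close>

locale partition_free_family = family +
  assumes pf: "partition_free \<F>"
begin

lemma pullback: "\<pi> permutes {1..n} \<Longrightarrow> partition_free {X. \<pi> ` X \<in> \<F>}"
  by (rule partition_free_vimage[OF pf permutes_inj])

lemma empty_notin: "{} \<notin> \<F>"
  using partition_freeD[OF pf, of "{}" "{}"] by auto

lemma f_0: "f 0 = 0"
proof -
  have "{A \<in> \<F>. card A = 0} = {}"
    using finite_member empty_notin card_0_eq by blast
  then show ?thesis
    unfolding dens_def by (simp only: card.empty)
qed

lemma dens_pair:
  assumes "s + t \<le> n"
  shows "f s + f t + f (s + t) \<le> 2"
proof -
  have u: "{1..s} \<union> {s+1..s+t} = {1..s+t}" "{1..s} \<inter> {s+1..s+t} = {}"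
    by auto
  have "(\<Sum>(c, X)\<leftarrow>[(1::real, {1..s}), (1, {s+1..s+t}), (1, {1..s+t})]. c * f (card X)) \<le> 2"
  proof (rule average_le)
    fix \<pi> assume "\<pi> permutes {1..n}"
    from local_pair[OF pullback[OF this] u(2)]
    show "(\<Sum>(c, X)\<leftarrow>[(1::real, {1..s}), (1, {s+1..s+t}), (1, {1..s+t})]. c * of_bool (\<pi> ` X \<in> \<F>)) \<le> 2"
      unfolding u(1) by simp
  qed (use assms in auto)
  then show ?thesis
    by simp
qed

lemma dens_point:
  assumes "2 * k + 1 \<le> n"
  shows "f (2 * k) + f (2 * k + 1) + 2 * f k + 2 * f (k + 1) \<le> 4"
proof -
  let ?B = "{1..k}" and ?C = "{k+1..2*k}" and ?a = "2*k+1"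
  let ?L = "[(1::real, ?B \<union> ?C), (1, insert ?a (?B \<union> ?C)), (1, ?B), (1, ?C), (1, insert ?a ?B), (1, insert ?a ?C)]"
  have "(\<Sum>(c, X)\<leftarrow>?L. c * f (card X)) \<le> 4"
  proof (rule average_le)
    fix \<pi> assume "\<pi> permutes {1..n}"
    from local_point[OF pullback[OF this], of ?B ?C ?a]
    show "(\<Sum>(c, X)\<leftarrow>?L. c * of_bool (\<pi> ` X \<in> \<F>)) \<le> 4"
      by (simp add: add.assoc)
  qed (use assms in auto)
  moreover have "?B \<union> ?C = {1..2*k}"
    by auto
  ultimately show ?thesis
    by simp
qed

text \<open>Since \<open>X\<close> and \<open>Z\<close> have the same size, every level occurs with
  an even total coefficient and the averaged inequality can be halved.\<close>

lemma dens_two_points: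
  assumes "2 * k + 2 \<le> n"
  shows "f (2 * k + 2) + 2 * f k + 2 * f (k + 1) + f (2 * k + 1) + f (2 * k) + 2 * f (k + 2) \<le> 6"
proof -
  let ?X = "{1..k}" and ?Z = "{k+1..2*k}" and ?a = "2*k+1" and ?b = "2*k+2"
  let ?L = "[(2::real, insert ?a (insert ?b (?X \<union> ?Z))), (2, ?X), (2, ?Z),
     (1, insert ?a ?X), (1, insert ?b ?X), (1, insert ?a ?Z), (1, insert ?b ?Z),
     (1, insert ?a (?X \<union> ?Z)), (1, insert ?b (?X \<union> ?Z)), (2, ?X \<union> ?Z),
     (2, insert ?a (insert ?b ?X)), (2, insert ?a (insert ?b ?Z))]"
  have "(\<Sum>(c, X)\<leftarrow>?L. c * f (card X)) \<le> 12"
  proof (rule average_le)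
    fix \<pi> assume "\<pi> permutes {1..n}"
    from local_two_points[OF pullback[OF this], of ?X ?Z ?a ?b]
    show "(\<Sum>(c, X)\<leftarrow>?L. c * of_bool (\<pi> ` X \<in> \<F>)) \<le> 12"
      by (simp add: add.assoc)
  qed (use assms in auto)
  moreover have "?X \<union> ?Z = {1..2*k}"
    by auto
  ultimately show ?thesis
    by (simp add: algebra_simps)
qed

end

section \<open>Intersecting families with an exchange property are stars\<close>

text \<open>Take members \<open>E\<close>, \<open>E'\<close> with smallest intersection and a common
  point \<open>q\<close>. Replacing \<open>q\<close> in \<open>E\<close> by an outside point never
  gives a member, so exchange puts every \<open>k\<close>-set meeting \<open>E\<close> only in
  \<open>q\<close> into \<open>Y\<close>; a second exchange reaches all \<open>k\<close>-sets
  through \<open>q\<close>.\<close>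

lemma star_of_exchange:
  fixes V :: "'a set"
  assumes V: "finite V" "3 * k \<le> card V + 1" and k: "k \<ge> 2"
    and Y: "\<And>E. E \<in> Y \<Longrightarrow> E \<subseteq> V \<and> card E = k" and ne: "Y \<noteq> {}"
    and int: "\<And>E P. E \<in> Y \<Longrightarrow> P \<in> Y \<Longrightarrow> E \<inter> P \<noteq> {}"
    and ex: "\<And>E P q u. E \<in> Y \<Longrightarrow> P \<subseteq> V \<Longrightarrow> card P = k \<Longrightarrow> E \<inter> P = {q} \<Longrightarrow> u \<in> V - E - P \<Longrightarrow>
      P \<in> Y \<or> insert u (E - {q}) \<in> Y"
  shows "\<exists>q\<in>V. Y = {E. E \<subseteq> V \<and> card E = k \<and> q \<in> E}"
proof -
  have fin: "finite E" if "E \<subseteq> V" for E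
    using V(1) that by (rule finite_subset[rotated])
  \<comment> \<open>Two \<open>k\<close>-sets sharing a point cover at most \<open>2k - 1\<close>
    points, which leaves \<open>k\<close> points free.\<close>
  have out: "k \<le> card (V - E - P)"
    if "E \<subseteq> V" "P \<subseteq> V" "card E = k" "card P = k" "q \<in> E" "q \<in> P" for E P q
  proof -
    have "card (E \<union> P) + card (E \<inter> P) = 2 * k"
      using card_Un_Int[of E P] that fin by simp
    moreover have "card (E \<inter> P) \<ge> 1"
      using that fin[of "E \<inter> P"] by (metis IntI One_nat_def Suc_leI card_gt_0_iff empty_iff le_infI1)
    moreover have "card (V - (E \<union> P)) = card V - card (E \<union> P)"
      using that fin by (intro card_Diff_subset) auto
    ultimately show ?thesis
      using V(2) k by (simp add: Diff_Diff_Int Diff_eq Int_assoc)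
  qed
  obtain E0 where "E0 \<in> Y" using ne by blast
  then have "(\<lambda>w. fst w \<in> Y \<and> snd w \<in> Y) (E0, E0)"
    by simp
  from ex_has_least_nat[where P = "\<lambda>w. fst w \<in> Y \<and> snd w \<in> Y", OF this, of "\<lambda>w. card (fst w \<inter> snd w)"]
  obtain E E' where E: "E \<in> Y" "E' \<in> Y"
    and min: "\<And>A B. A \<in> Y \<Longrightarrow> B \<in> Y \<Longrightarrow> card (E \<inter> E') \<le> card (A \<inter> B)"
    by auto
  obtain q where q: "q \<in> E" "q \<in> E'"
    using int[OF E] by blast
  \<comment> \<open>Such a swap would shrink the minimal intersection with
    \<open>E'\<close>.\<close>
  have far: "insert u (E - {q}) \<notin> Y" if "u \<in> V - E - E'" for u
  proof
    assume "insert u (E - {q}) \<in> Y"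
    moreover have "insert u (E - {q}) \<inter> E' = E \<inter> E' - {q}"
      using that by auto
    moreover have "card (E \<inter> E' - {q}) < card (E \<inter> E')"
      using q fin Y[OF E(1)] by (intro psubset_card_mono) auto
    ultimately show False
      using min[OF _ E(2)] by fastforce
  qed
  obtain v where v: "v \<in> V - E - E'"
    using out[of E E' q] Y[OF E(1)] Y[OF E(2)] q k by (metis card.empty ex_in_conv not_numeral_le_zero le_trans)
  \<comment> \<open>Now \<open>u\<close> may lie in \<open>E'\<close>. A \<open>k\<close>-set
    meeting \<open>E\<close> only in \<open>q\<close> and avoiding \<open>u\<close> and
    \<open>v\<close> is a member by exchange along \<open>v\<close>, yet it is disjoint from the
    swapped set.\<close>
  have near: "insert u (E - {q}) \<notin> Y" if u: "u \<in> V - E" for u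
  proof
    assume uY: "insert u (E - {q}) \<in> Y"
    have cE: "card (V - E) = card V - k"
      using Y[OF E(1)] fin by (simp add: card_Diff_subset)
    have "card (V - E - {u, v}) \<ge> card (V - E) - card {u, v}"
      by (rule diff_card_le_card_Diff) simp
    moreover have "card {u, v} \<le> 2"
      by (simp add: card_insert_if)
    ultimately have "k - 1 \<le> card (V - E - {u, v})"
      using cE V(2) k by linarith
    then obtain R where R: "R \<subseteq> V - E - {u, v}" "card R = k - 1" "finite R"
      by (rule obtain_subset_with_card_n)
    have "card (insert q R) = k"
      using R q k by (subst card_insert_disjoint) auto
    then have "insert q R \<in> Y \<or> insert v (E - {q}) \<in> Y"
      using R q Y[OF E(1)] v by (intro ex[OF E(1)]) auto
    moreover have "insert q R \<notin> Y"
      using int[OF uY, of "insert q R"] R u q by auto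
    ultimately show False
      using far[OF v] by blast
  qed
  have pinned: "P \<in> Y" if "P \<subseteq> V" "card P = k" "E \<inter> P = {q}" for P
  proof -
    have "V - E - P \<noteq> {}"
      using out[of E P q] Y[OF E(1)] that q k by (metis Int_iff card.empty insertI1 not_numeral_le_zero le_trans)
    then obtain u where u: "u \<in> V - E - P" by blast
    with ex[OF E(1) that u] near[of u] show ?thesis by blast
  qed
  \<comment> \<open>The detour goes through a member \<open>insert q R\<close> that meets both
    \<open>E\<close> and \<open>W\<close> only in \<open>q\<close>; the other outcome of the
    exchange is disjoint from \<open>E\<close>.\<close>
  have star: "W \<in> Y" if W: "W \<subseteq> V" "card W = k" "q \<in> W" for W
  proof -
    have c: "k \<le> card (V - E - W)"
      using out[of E W q] Y[OF E(1)] W q by blast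
    then obtain R where R: "R \<subseteq> V - E - W" "card R = k - 1" "finite R"
      by (meson diff_le_self le_trans obtain_subset_with_card_n)
    then have "R \<noteq> V - E - W"
      using c k by auto
    then obtain u where u: "u \<in> V - E - W" "u \<notin> R"
      using R by blast
    have P: "insert q R \<in> Y"
      using R q Y[OF E(1)] k by (intro pinned) (auto simp: card_insert_if)
    have "W \<in> Y \<or> insert u (insert q R - {q}) \<in> Y"
      using R W u q by (intro ex[OF P W(1,2)]) auto
    moreover have "insert u (insert q R - {q}) \<notin> Y"
      using int[OF E(1), of "insert u (insert q R - {q})"] R u by auto
    ultimately show ?thesis by blast
  qed
  have "q \<in> W" if W: "W \<in> Y" for W
  proof (rule ccontr)
    assume nq: "q \<notin> W"
    have "card (V - W - {q}) \<ge> card (V - W) - card {q}"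
      by (rule diff_card_le_card_Diff) simp
    moreover have "card (V - W) = card V - k"
      using Y[OF W] fin by (simp add: card_Diff_subset)
    ultimately have "k - 1 \<le> card (V - W - {q})"
      using V(2) k by simp
    then obtain R where R: "R \<subseteq> V - W - {q}" "card R = k - 1" "finite R"
      by (rule obtain_subset_with_card_n)
    have "insert q R \<in> Y"
      using R q Y[OF E(1)] k by (intro star) (auto simp: card_insert_if)
    then show False
      using int[OF W] R nq by blast
  qed
  then have "Y = {E. E \<subseteq> V \<and> card E = k \<and> q \<in> E}"
    using star Y by blast
  moreover have "q \<in> V"
    using q Y[OF E(1)] by blast
  ultimately show ?thesis by blast
qed

section \<open>Arcs of a cyclic ordering\<close>

text \<open>A block of consecutive residues modulo \<open>N\<close>. The start is any natural
  number, so starts such as \<open>i + m\<close> need no reduction.\<close>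

definition arc :: "nat \<Rightarrow> nat \<Rightarrow> nat \<Rightarrow> nat set" where
  "arc N i k = (\<lambda>j. (i + j) mod N) ` {..<k}"

lemma arc_mod [simp]: "arc N (i mod N) k = arc N i k"
  by (simp add: arc_def mod_add_left_eq)

lemma arc_mono: "k \<le> l \<Longrightarrow> arc N i k \<subseteq> arc N i l"
  unfolding arc_def by (intro image_mono) auto

lemma arc_subset: "N > 0 \<Longrightarrow> arc N i k \<subseteq> {..<N}"
  by (auto simp: arc_def)

lemma arc_Un: "arc N i k \<union> arc N (i + k) l = arc N i (k + l)"
proof -
  have "{..<k + l} = {..<k} \<union> (+) k ` {..<l}"
    by (auto simp: image_iff) (metis add_diff_inverse_nat add_less_cancel_left lessThan_iff)
  then show ?thesis
    unfolding arc_def by (simp add: image_Un image_image add.assoc)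
qed

lemma inj_on_arc: "inj_on (\<lambda>j. (i + j) mod N) {..<N :: nat}"
proof (rule linorder_inj_onI')
  fix j k assume jk: "j \<in> {..<N}" "k \<in> {..<N}" "j < k"
  show "(i + j) mod N \<noteq> (i + k) mod N"
  proof
    assume "(i + j) mod N = (i + k) mod N"
    then have "N dvd k - j"
      using jk(3) mod_eq_dvd_iff_nat[of "i + j" "i + k" N] by simp
    then show False
      using jk by (auto dest: dvd_imp_le)
  qed
qed

lemma card_arc: "k \<le> N \<Longrightarrow> card (arc N i k) = k"
  unfolding arc_def by (subst card_image) (auto intro: inj_on_subset[OF inj_on_arc])

lemma arc_full: "N > 0 \<Longrightarrow> arc N i N = {..<N}"
  by (rule card_subset_eq) (simp_all add: arc_subset card_arc)

lemma arc_disjoint: "k + l \<le> N \<Longrightarrow> arc N i k \<inter> arc N (i + k) l = {}"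
proof -
  assume "k + l \<le> N"
  then have "card (arc N i k \<inter> arc N (i + k) l) = 0"
    using card_Un_Int[of "arc N i k" "arc N (i + k) l"]
    by (simp add: arc_Un card_arc) (simp add: arc_def)
  then show ?thesis
    by (simp add: arc_def)
qed

text \<open>Rotation permutes the starts of the arcs, so summands can be realigned before a termwise
  estimate.\<close>

lemma sum_shift:
  assumes "N > 0" "\<And>i. g (i mod N) = g i"
  shows "(\<Sum>i<N. g (i + k)) = (\<Sum>i<N::nat. g i)"
proof -
  have "(\<Sum>i<N. g (i + k)) = (\<Sum>i<N. g ((k + i) mod N))"
    by (simp add: assms(2) add.commute)
  also have "\<dots> = (\<Sum>i\<in>arc N k N. g i)"
    unfolding arc_def by (rule sum.reindex_cong[symmetric, OF inj_on_arc]) auto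
  finally show ?thesis
    by (simp add: arc_full assms(1))
qed

text \<open>For \<open>N = 2m + 1\<close> the arcs of length \<open>m\<close> starting at \<open>i\<close> and \<open>i + m\<close> are disjoint. This makes
  disjointness of \<open>m\<close>-arcs an odd cycle, so more than \<open>m\<close> members force missing arcs of length \<open>2m\<close>,
  as in Katona's proof of the Erdos-Ko-Rado theorem.\<close>

lemma local_cycle:
  fixes m :: nat
  defines "N \<equiv> 2 * m + 1"
  assumes pf: "partition_free \<G>" and m: "m \<ge> 1"
  shows "real m * of_bool ({..<N} \<in> \<G>) + (\<Sum>i<N. of_bool (arc N i m \<in> \<G>) + of_bool (arc N i (m - 1) \<in> \<G>)
      + of_bool (arc N i (2 * m) \<in> \<G>) + of_bool (arc N i (m + 1) \<in> \<G>) + of_bool (arc N i (m + 2) \<in> \<G>)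
      + of_bool (arc N i (m - 1) \<union> arc N (i + m) m \<in> \<G>)) \<le> real (m + 4 * N)"
proof -
  define a s c d d' z :: "nat \<Rightarrow> real" where
    "a i = of_bool (arc N i m \<in> \<G>)" and "s i = of_bool (arc N i (m - 1) \<in> \<G>)" and
    "c i = of_bool (arc N i (2 * m) \<in> \<G>)" and "d i = of_bool (arc N i (m + 1) \<in> \<G>)" and
    "d' i = of_bool (arc N i (m + 2) \<in> \<G>)" and
    "z i = of_bool (arc N i (m - 1) \<union> arc N (i + m) m \<in> \<G>)" for i
  note defs = a_def s_def c_def d_def d'_def z_def
  have N: "N > 0" and N_real: "real N = 2 * m + 1" by (simp_all add: N_def)
  have shift: "(\<Sum>i<N. a (i + k)) = (\<Sum>i<N. a i)" "(\<Sum>i<N. d (i + k)) = (\<Sum>i<N. d i)"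
    "(\<Sum>i<N. d' (i + k)) = (\<Sum>i<N. d' i)" for k
    by (rule sum_shift[OF N], simp add: defs)+
  have le1: "a i \<le> 1" "s i \<le> 1" "c i \<le> 1" "d i \<le> 1" "d' i \<le> 1" "z i \<le> 1" for i
    by (simp_all add: defs)
  have free: "\<not> (arc N i k \<in> \<G> \<and> arc N (i + k) l \<in> \<G> \<and> arc N i (k + l) \<in> \<G>)" if "k + l \<le> N" for i k l
    using partition_freeD[OF pf _ _ arc_disjoint[OF that]] arc_Un by metis
  have "real m * of_bool ({..<N} \<in> \<G>) + (\<Sum>i<N. a i + s i + c i + d i + d' i + z i) \<le> real (m + 4 * N)"
  proof (cases "{..<N} \<in> \<G>")
    case True
    \<comment> \<open>With the whole cycle present, an arc and its complement cannot both be
      present; this pairs length \<open>m\<close> with \<open>m + 1\<close> and \<open>m - 1\<close>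
      with \<open>m + 2\<close>.\<close>
    have "a i + d (i + m) \<le> 1" for i
      using free[of m "m + 1" i] True arc_full[OF N, of i] by (auto simp: defs N_def mult_2)
    moreover have "s i + d' (i + (m - 1)) \<le> 1" for i
      using free[of "m - 1" "m + 2" i] True arc_full[OF N, of i] m by (auto simp: defs N_def mult_2)
    ultimately have "a i + s i + c i + d (i + m) + d' (i + (m - 1)) + z i \<le> 4" for i
      using le1(3,6)[of i] by (smt (verit))
    then have "(\<Sum>i<N. a i + s i + c i + d (i + m) + d' (i + (m - 1)) + z i) \<le> (\<Sum>i<N. 4)"
      by (intro sum_mono)
    then show ?thesis
      using True by (simp add: sum.distrib shift)
  next
    case False
    \<comment> \<open>Two consecutive present \<open>m\<close>-arcs exclude the
      \<open>2m\<close>-arc of \<open>c i\<close>, and together with a present arc of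
      \<open>s i\<close> also the set of \<open>z i\<close>.\<close>
    define e :: "nat \<Rightarrow> real" where "e i = of_bool (arc N i m \<in> \<G> \<and> arc N (i + m) m \<in> \<G>)" for i
    have "e i + s i + c i + d (i + (m - 1)) + z i \<le> 3" for i
    proof -
      have "\<not> (arc N i m \<in> \<G> \<and> arc N (i + m) m \<in> \<G> \<and> arc N i (2 * m) \<in> \<G>)"
        using free[of m m i] by (simp add: N_def mult_2)
      moreover have "\<not> (arc N i (m - 1) \<in> \<G> \<and> arc N (i + (m - 1)) (m + 1) \<in> \<G> \<and> arc N i (2 * m) \<in> \<G>)"
        using free[of "m - 1" "m + 1" i] m by (simp add: N_def mult_2)
      moreover have "arc N i (m - 1) \<inter> arc N (i + m) m = {}"
        using arc_disjoint[of m m N i] arc_mono[of "m - 1" m N i] by (auto simp: N_def)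
      then have "\<not> (arc N i (m - 1) \<in> \<G> \<and> arc N (i + m) m \<in> \<G> \<and> arc N i (m - 1) \<union> arc N (i + m) m \<in> \<G>)"
        using partition_freeD[OF pf] by blast
      ultimately show ?thesis
        unfolding e_def defs of_bool_def by (auto split: if_splits)
    qed
    then have "e i + s i + c i + d (i + (m - 1)) + d' i + z i \<le> 4" for i
      using le1(5)[of i] by (smt (verit))
    then have "(\<Sum>i<N. e i + s i + c i + d (i + (m - 1)) + d' i + z i) \<le> (\<Sum>i<N. 4)"
      by (intro sum_mono)
    then have 1: "(\<Sum>i<N. e i) + (\<Sum>i<N. s i + c i + d i + d' i + z i) \<le> 4 * N"
      by (simp add: sum.distrib shift)
    have "(\<Sum>i<N. a i + a (i + m)) \<le> (\<Sum>i<N. e i + 1)"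
      by (intro sum_mono) (auto simp: e_def defs)
    then have 2: "2 * (\<Sum>i<N. a i) \<le> (\<Sum>i<N. e i) + (2 * m + 1)"
      using N_real by (simp add: sum.distrib shift)
    have 3: "(\<Sum>i<N. e i) \<ge> 0"
      by (intro sum_nonneg) (simp add: e_def)
    \<comment> \<open>Integrality closes the gap left by the odd cycle: if more than
      \<open>m\<close> of the \<open>m\<close>-arcs are present, then at least \<open>m + 1\<close>
      are, and this absorbs the extra 1 in the previous bound.\<close>
    have "(\<Sum>i<N. a i) = real (card {i. i < N \<and> arc N i m \<in> \<G>})"
      by (simp add: a_def of_bool_def sum.If_cases Int_def)
    then obtain x :: nat where x: "(\<Sum>i<N. a i) = real x" by blast
    have "(\<Sum>i<N. a i) \<le> (\<Sum>i<N. e i) + m"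
      using 2 3 unfolding x by (cases "x \<le> m") auto
    then show ?thesis
      using 1 False by (simp add: sum.distrib)
  qed
  then show ?thesis
    by (simp add: defs)
qed

text \<open>The configuration of the cyclic inequality as a weighted list; \<open>Suc\<close> moves
  the residues from 0 to \<open>2m\<close> into the ground set, which starts at 1.\<close>

definition cycle_sets :: "nat \<Rightarrow> (real \<times> nat set) list" where
  "cycle_sets m = (let N = 2 * m + 1 in (real m, Suc ` {..<N}) #
     map (\<lambda>i. (1, Suc ` arc N i m)) [0..<N] @ map (\<lambda>i. (1, Suc ` arc N i (m - 1))) [0..<N] @
     map (\<lambda>i. (1, Suc ` arc N i (2 * m))) [0..<N] @ map (\<lambda>i. (1, Suc ` arc N i (m + 1))) [0..<N] @
     map (\<lambda>i. (1, Suc ` arc N i (m + 2))) [0..<N] @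
     map (\<lambda>i. (1, Suc ` (arc N i (m - 1) \<union> arc N (i + m) m))) [0..<N])"

lemma sum_cycle_sets:
  fixes m :: nat and g :: "nat set \<Rightarrow> real"
  defines "N \<equiv> 2 * m + 1"
  shows "(\<Sum>(c, X)\<leftarrow>cycle_sets m. c * g X) = m * g (Suc ` {..<N}) + (\<Sum>i<N. g (Suc ` arc N i m)
      + g (Suc ` arc N i (m - 1)) + g (Suc ` arc N i (2 * m)) + g (Suc ` arc N i (m + 1))
      + g (Suc ` arc N i (m + 2)) + g (Suc ` (arc N i (m - 1) \<union> arc N (i + m) m)))"
  unfolding cycle_sets_def Let_def N_def[symmetric]
  by (simp add: comp_def sum_list_distinct_conv_sum_set atLeast0LessThan sum.distrib)

section \<open>Averaging the cyclic inequality\<close>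

context partition_free_family
begin

lemma cycle_sets_subset: "2 * m + 1 \<le> n \<Longrightarrow> (c, X) \<in> set (cycle_sets m) \<Longrightarrow> X \<subseteq> {1..n}"
  using arc_subset[of "2 * m + 1"] unfolding cycle_sets_def Let_def by fastforce

lemma local_cycle_sets:
  assumes "m \<ge> 1" "\<pi> permutes {1..n}"
  shows "(\<Sum>(c, X)\<leftarrow>cycle_sets m. c * of_bool (\<pi> ` X \<in> \<F>)) \<le> real (m + 4 * (2 * m + 1))"
proof -
  have "inj (\<pi> \<circ> Suc)"
    using permutes_inj[OF assms(2)] by (simp add: inj_compose)
  from local_cycle[OF partition_free_vimage[OF pf this] assms(1)]
  show ?thesis
    unfolding sum_cycle_sets mem_Collect_eq image_comp[symmetric] .
qed

text \<open>The union is an arc of length \<open>2m\<close> without its point at offset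
  \<open>m - 1\<close>.\<close>

lemma card_cycle_union:
  assumes "m \<ge> 1" "2 * m \<le> N"
  shows "card (arc N i (m - 1) \<union> arc N (i + m) m) = 2 * m - 1"
proof -
  have "arc N i (m - 1) \<inter> arc N (i + m) m = {}"
    using assms(2) arc_disjoint[of m m N i] arc_mono[of "m - 1" m N i] by auto
  moreover have "finite (arc N j k)" for j k
    by (simp add: arc_def)
  ultimately show ?thesis
    using assms by (simp add: card_Un_disjoint card_arc)
qed

lemma sum_dens_cycle:
  fixes m :: nat
  defines "N \<equiv> 2 * m + 1"
  assumes "m \<ge> 1"
  shows "(\<Sum>(c, X)\<leftarrow>cycle_sets m. c * f (card X)) =
    m * f (2 * m + 1) + real N * (f m + f (m - 1) + f (2 * m) + f (m + 1) + f (m + 2) + f (2 * m - 1))"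
proof -
  have "m \<le> N" "m - 1 \<le> N" "2 * m \<le> N" "m + 1 \<le> N" "m + 2 \<le> N"
    using assms(2) by (auto simp: N_def)
  moreover have "card (Suc ` {..<N}) = 2 * m + 1"
    by (simp add: card_image N_def)
  moreover have "card (arc N i (m - 1) \<union> arc N (i + m) m) = 2 * m - 1" for i
    using assms(2) calculation by (intro card_cycle_union) auto
  moreover have "card (Suc ` X) = card X" for X
    by (simp add: card_image)
  ultimately show ?thesis
    unfolding sum_cycle_sets N_def[symmetric]
    by (simp only: card_arc) (simp add: distrib_left sum.distrib)
qed

lemma dens_cycle:
  assumes "m \<ge> 1" "2 * m + 1 \<le> n"
  shows "m * f (2 * m + 1) + real (2 * m + 1) * (f m + f (m - 1) + f (2 * m) + f (m + 1) + f (m + 2) + f (2 * m - 1))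
    \<le> real (m + 4 * (2 * m + 1))"
  unfolding sum_dens_cycle[OF assms(1), symmetric]
  by (rule average_le) (fact local_cycle_sets[OF assms(1)], fact cycle_sets_subset[OF assms(2)])

text \<open>Tightness holds for every injective labelling \<open>e\<close> of the cycle, because
  \<open>e\<close>, shifted by one, extends to a permutation of \<open>{1..n}\<close>.\<close>

lemma local_cycle_eq:
  fixes m :: nat
  defines "N \<equiv> 2 * m + 1"
  assumes m: "m \<ge> 1" "N \<le> n"
    and eq: "m * f (2 * m + 1) + real N * (f m + f (m - 1) + f (2 * m) + f (m + 1) + f (m + 2) + f (2 * m - 1))
      = real (m + 4 * N)"
    and e: "inj_on e {..<N}" "e ` {..<N} \<subseteq> {1..n}"
  shows "real m * of_bool (e ` {..<N} \<in> \<F>) + (\<Sum>i<N. of_bool (e ` arc N i m \<in> \<F>) + of_bool (e ` arc N i (m - 1) \<in> \<F>)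
      + of_bool (e ` arc N i (2 * m) \<in> \<F>) + of_bool (e ` arc N i (m + 1) \<in> \<F>) + of_bool (e ` arc N i (m + 2) \<in> \<F>)
      + of_bool (e ` (arc N i (m - 1) \<union> arc N (i + m) m) \<in> \<F>)) = real (m + 4 * N)"
proof -
  have N: "N > 0" by (simp add: N_def)
  obtain \<pi> where \<pi>: "\<pi> permutes {1..n}" "\<And>x. x \<in> Suc ` {..<N} \<Longrightarrow> \<pi> x = (e \<circ> (\<lambda>x. x - 1)) x"
  proof (rule permutes_extend[of "{1..n}" "Suc ` {..<N}" "e \<circ> (\<lambda>x. x - 1)"])
    show "inj_on (e \<circ> (\<lambda>x. x - 1)) (Suc ` {..<N})"
      using e(1) by (auto simp: inj_on_def)
    show "(e \<circ> (\<lambda>x. x - 1)) ` Suc ` {..<N} \<subseteq> {1..n}"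
      using e(2) by auto
    show "Suc ` {..<N} \<subseteq> {1..n}"
      using m by auto
  qed auto
  have im: "\<pi> ` Suc ` X = e ` X" if "X \<subseteq> {..<N}" for X
    using \<pi>(2) that by (auto simp: image_image subset_iff intro!: image_cong)
  have arcs: "\<pi> ` Suc ` arc N i k = e ` arc N i k"
    "\<pi> ` Suc ` (arc N i k \<union> arc N j l) = e ` (arc N i k \<union> arc N j l)" for i j k l
    using arc_subset[OF N] by (intro im; blast)+
  have "(\<Sum>(c, X)\<leftarrow>cycle_sets m. c * of_bool (\<pi> ` X \<in> \<F>)) = real (m + 4 * (2 * m + 1))"
    using eq unfolding N_def sum_dens_cycle[OF m(1), symmetric]
    by (rule average_eq[rotated 2]) (fact \<pi>(1) local_cycle_sets[OF m(1)] cycle_sets_subset[OF m(2)[unfolded N_def]])+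
  then show ?thesis
    unfolding sum_cycle_sets N_def[symmetric] arcs im[OF order_refl] .
qed

end

section \<open>Binomial estimates\<close>

lemma choose_step: "k \<le> n \<Longrightarrow> (real k + 1) * (n choose (k + 1)) = (real n - real k) * (n choose k)"
proof -
  assume k: "k \<le> n"
  have "Suc k * (n choose Suc k) = (n - k) * (n choose k)"
    by (simp only: binomial_absorption binomial_absorb_comp)
  from arg_cong[OF this, of real] show ?thesis
    using k by (simp only: of_nat_mult of_nat_diff of_nat_Suc Suc_eq_plus1 of_nat_add of_nat_1)
qed

text \<open>The ratio of consecutive binomials, \<open>(n - k) / (k + 1)\<close>, is at least 2 in
  this range.\<close>

lemma choose_double: "3 * k + 2 \<le> n \<Longrightarrow> 2 * real (n choose k) \<le> n choose (k + 1)"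
proof -
  assume k: "3 * k + 2 \<le> n"
  have "(real k + 1) * (2 * real (n choose k)) \<le> (real n - real k) * (n choose k)"
    using k by (simp add: mult.assoc[symmetric] mult_right_mono)
  also have "\<dots> = (real k + 1) * (n choose (k + 1))"
    using k choose_step[of k n] by simp
  finally show ?thesis
    by (simp add: mult_le_cancel_left_pos)
qed

text \<open>By \<open>choose_double\<close> the sum is dominated by a geometric series of ratio one
  half.\<close>

lemma sum_choose_le: "3 * p \<le> n + 1 \<Longrightarrow> (\<Sum>s\<le>p. real (n choose s)) \<le> 2 * real (n choose p)"
proof (induction p)
  case (Suc p)
  then show ?case
    using choose_double[of p n] by simp
qed simp

lemma choose_middle: "a \<le> t \<Longrightarrow> t + a \<le> n \<Longrightarrow> n choose a \<le> n choose t"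
proof (cases "2 * t \<le> n")
  case True
  then show "a \<le> t \<Longrightarrow> ?thesis"
    by (simp add: binomial_mono)
next
  case False
  assume "t + a \<le> n"
  moreover from this have "n choose t = n choose (n - t)"
    by (intro binomial_symmetric) simp
  ultimately show ?thesis
    using False by (simp add: binomial_mono)
qed

section \<open>Grouping the levels for the charging argument\<close>

lemma sum_reverse:
  fixes g :: "nat \<Rightarrow> 'a :: comm_monoid_add"
  assumes "k \<le> b"
  shows "sum g {b - k..b} = (\<Sum>s\<le>k. g (b - s))"
  by (rule sum.reindex_bij_witness[where i = "\<lambda>s. b - s" and j = "\<lambda>t. b - t"]) (use assms in auto)

text \<open>The outer levels \<open>s\<close> and \<open>3m - s\<close> are grouped with the window
  level \<open>2m - 1 - s\<close> that pays for them: \<open>s + (2m - 1 - s) = 2m - 1\<close> and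
  \<open>(m + 1) + (2m - 1 - s) = 3m - s\<close>. Four levels next to the window's ends stay
  apart.\<close>

lemma sum_split_3m:
  fixes g :: "nat \<Rightarrow> 'a :: comm_monoid_add"
  assumes "m \<ge> 2"
  shows "sum g {..3 * m} =
    (\<Sum>s\<le>m - 2. g s + g (2 * m - 1 - s) + g (3 * m - s)) + (g (m - 1) + g m + g (2 * m) + g (2 * m + 1))"
    and "sum g {m + 1..2 * m + 1} = (\<Sum>s\<le>m - 2. g (2 * m - 1 - s)) + (g (2 * m) + g (2 * m + 1))"
proof -
  have 1: "{..3 * m} = {..m - 2} \<union> ({m - 1, m} \<union> ({m + 1..2 * m - 1} \<union> ({2 * m, 2 * m + 1} \<union> {2 * m + 2..3 * m})))"
    using assms by auto
  have 2: "{m + 1..2 * m + 1} = {m + 1..2 * m - 1} \<union> {2 * m, 2 * m + 1}"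
    using assms by auto
  have 3: "sum g {m + 1..2 * m - 1} = (\<Sum>s\<le>m - 2. g (2 * m - 1 - s))"
    using sum_reverse[of "m - 2" "2 * m - 1" g] assms by (simp add: numeral_2_eq_2 Suc_diff_Suc)
  have 4: "sum g {2 * m + 2..3 * m} = (\<Sum>s\<le>m - 2. g (3 * m - s))"
    using sum_reverse[of "m - 2" "3 * m" g] assms by simp
  show "sum g {m + 1..2 * m + 1} = (\<Sum>s\<le>m - 2. g (2 * m - 1 - s)) + (g (2 * m) + g (2 * m + 1))"
    unfolding 2 by (subst sum.union_disjoint) (use assms 3 in auto)
  show "sum g {..3 * m} =
    (\<Sum>s\<le>m - 2. g s + g (2 * m - 1 - s) + g (3 * m - s)) + (g (m - 1) + g m + g (2 * m) + g (2 * m + 1))"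
    unfolding 1
    by (subst sum.union_disjoint, simp, simp, use assms in force)+
      (use assms 3 4 in \<open>simp add: sum.distrib ac_simps\<close>)
qed

text \<open>The paying window level is now \<open>2m - s\<close>, because
  \<open>(m + 2) + (2m - s) = 3m + 2 - s\<close>. Low levels will be charged with a shift by one,
  using \<open>(s + 1) + (2m - s) = 2m + 1\<close>.\<close>

lemma sum_split_3m2:
  fixes g :: "nat \<Rightarrow> 'a :: comm_monoid_add"
  assumes "m \<ge> 2"
  shows "sum g {..3 * m + 2} = (\<Sum>s\<le>m - 2. g s + g (2 * m - s) + g (3 * m + 2 - s)) +
      (g (m - 1) + g m + g (m + 1) + g (2 * m + 1) + g (2 * m + 2) + g (2 * m + 3))"
    and "sum g {m + 1..2 * m + 1} = (\<Sum>s\<le>m - 2. g (2 * m - s)) + (g (m + 1) + g (2 * m + 1))"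
proof -
  have 1: "{..3 * m + 2} = {..m - 2} \<union> ({m - 1, m, m + 1} \<union> ({m + 2..2 * m} \<union>
      ({2 * m + 1, 2 * m + 2, 2 * m + 3} \<union> {2 * m + 4..3 * m + 2})))"
    using assms by auto
  have 2: "{m + 1..2 * m + 1} = {m + 2..2 * m} \<union> {m + 1, 2 * m + 1}"
    using assms by auto
  have 3: "sum g {m + 2..2 * m} = (\<Sum>s\<le>m - 2. g (2 * m - s))"
    using sum_reverse[of "m - 2" "2 * m" g] assms by simp
  have 4: "sum g {2 * m + 4..3 * m + 2} = (\<Sum>s\<le>m - 2. g (3 * m + 2 - s))"
    using sum_reverse[of "m - 2" "3 * m + 2" g] assms by simp
  have "m - 1 \<noteq> m" "m - 1 \<noteq> m + 1"
    using assms by auto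
  then have 5: "sum g {m - 1, m, m + 1} = g (m - 1) + (g m + g (m + 1))"
    by simp
  show "sum g {m + 1..2 * m + 1} = (\<Sum>s\<le>m - 2. g (2 * m - s)) + (g (m + 1) + g (2 * m + 1))"
    unfolding 2 by (subst sum.union_disjoint) (use assms 3 in auto)
  show "sum g {..3 * m + 2} = (\<Sum>s\<le>m - 2. g s + g (2 * m - s) + g (3 * m + 2 - s)) +
      (g (m - 1) + g m + g (m + 1) + g (2 * m + 1) + g (2 * m + 2) + g (2 * m + 3))"
    unfolding 1
    by (subst sum.union_disjoint, simp, simp, use assms in force)+
      (use assms 3 4 5 in \<open>simp add: sum.distrib ac_simps\<close>)
qed

section \<open>The upper bounds\<close>

context partition_free_family
begin

text \<open>The deficit \<open>D\<close> is expressed through the missing proportions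
  \<open>Y\<close>. Pair inequalities charge the outer levels, the cyclic inequality charges levels
  \<open>m - 1\<close> and \<open>m\<close>, and the coefficients left on \<open>Y\<close> are
  positive, so equality forces \<open>Y\<close> to vanish. The terms of levels \<open>2m\<close> and
  \<open>2m + 1\<close> are used up exactly; hence these stay tied to level \<open>m\<close> by one
  equation only.\<close>

lemma bound_3m:
  assumes n: "n = 3 * m" and m: "m \<ge> 6"
  defines "S \<equiv> \<Sum>t = m + 1..2 * m + 1. n choose t"
  shows "card \<F> \<le> S"
    and "card \<F> = S \<Longrightarrow> s \<le> m - 2 \<Longrightarrow> f (2 * m - 1 - s) = 1 \<and> f s = 0 \<and> f (3 * m - s) = 0"
    and "card \<F> = S \<Longrightarrow> f (m - 1) = 0"
    and "card \<F> = S \<Longrightarrow> real (2 * m + 1) * f m = m * (1 - f (2 * m + 1)) + real (2 * m + 1) * (1 - f (2 * m))"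
proof -
  define C where "C t = real (n choose t)" for t
  define Y where "Y s = 1 - f (2 * m - 1 - s)" for s
  define D where "D = real S - real (card \<F>)"
  define \<sigma> where "\<sigma> = (\<Sum>s\<le>m - 2. C s)"
  \<comment> \<open>What remains of the weight of a window level: \<open>2 * C s\<close> pays for
    its own group, while \<open>s = 0\<close>, \<open>m - 2\<close>, \<open>m - 3\<close> (levels
    \<open>2m - 1\<close>, \<open>m + 1\<close>, \<open>m + 2\<close>) pay extra in the cyclic
    inequality, the first two also in every group.\<close>
  define \<kappa> where "\<kappa> s = C (2 * m - 1 - s) - 2 * C s - (if s = 0 then \<sigma> + C m else 0)
      - (if s = m - 2 then \<sigma> + C m else 0) - (if s = m - 3 then C m else 0)" for s
  have sym: "C (2 * m) = C m" "C (2 * m + 1) = C (m - 1)" "s \<le> 3 * m \<Longrightarrow> C (3 * m - s) = C s" for s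
    unfolding C_def n using m binomial_symmetric[of m "3 * m"] binomial_symmetric[of "m - 1" "3 * m"]
      binomial_symmetric[of s "3 * m"] by (simp_all add: numeral_eq_Suc)
  have Cm: "C m > 0"
    by (simp add: C_def n)
  have C1: "real m * C m = (2 * real m + 1) * C (m - 1)"
    using choose_step[of "m - 1" n] m by (simp add: C_def n of_nat_diff)
  have C2: "(real m + 1) * C (m + 1) = 2 * real m * C m"
    using choose_step[of m n] by (simp add: C_def n)
  have C3: "(real m - 1) * C (m - 1) = (2 * real m + 2) * C (m - 2)"
    using choose_step[of "m - 2" n] m by (simp add: C_def n of_nat_diff Suc_diff_Suc numeral_2_eq_2)
  have C1_less: "C (m - 1) < C m"
  proof -
    have "(2 * real m + 1) * C (m - 1) < (2 * real m + 1) * C m"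
      unfolding C1[symmetric] using Cm m by (intro mult_strict_right_mono) auto
    then show ?thesis
      by (simp add: mult_less_cancel_left_pos)
  qed
  \<comment> \<open>Window levels up to \<open>2m - 1\<close> weigh at least
    \<open>C (m + 1)\<close>, so this makes every \<open>\<kappa> s\<close> positive.\<close>
  have key: "C (m + 1) > C m + 2 * C (m - 2) + \<sigma>"
  proof -
    have X: "(real m - 1) * C (m - 1) > 0"
      using m by (simp add: C_def n)
    have "real m * ((real m + 1) * (C m + 4 * C (m - 2))) =
        (real m + 1) * (real m * C m) + 2 * real m * ((2 * real m + 2) * C (m - 2))"
      by algebra
    also have "\<dots> = (real m + 1) * (real m * C m) + 2 * real m * ((real m - 1) * C (m - 1))"
      unfolding C3 ..
    also have "\<dots> = (real m + 1) * (real m * C m) + (real m - 1) * (real m * C m) - (real m - 1) * C (m - 1)"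
      unfolding C1 by algebra
    also have "\<dots> = real m * ((real m + 1) * C (m + 1)) - (real m - 1) * C (m - 1)"
      unfolding C2 by algebra
    finally have "real m * ((real m + 1) * (C m + 4 * C (m - 2))) < real m * ((real m + 1) * C (m + 1))"
      using X by linarith
    then have "C m + 4 * C (m - 2) < C (m + 1)"
      using m by simp
    moreover have "\<sigma> \<le> 2 * C (m - 2)"
      unfolding \<sigma>_def C_def using m by (intro sum_choose_le) (simp add: n)
    ultimately show ?thesis by simp
  qed
  have \<kappa>: "\<kappa> s > 0" if s: "s \<le> m - 2" for s
  proof -
    have a: "C (m + 1) \<le> C (2 * m - 1 - s)"
      unfolding C_def of_nat_le_iff using s m by (intro choose_middle) (auto simp: n)
    have b: "C s \<le> C (m - 2)"
      unfolding C_def of_nat_le_iff using s m by (intro binomial_mono) (auto simp: n)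
    have "\<sigma> \<ge> 0"
      unfolding \<sigma>_def C_def by (intro sum_nonneg) simp
    then show ?thesis
      using a b key Cm m unfolding \<kappa>_def by auto
  qed
  have Y0: "Y s \<ge> 0" for s
    by (simp add: Y_def)
  have Ym: "Y 0 = 1 - f (2 * m - 1)" "Y (m - 2) = 1 - f (m + 1)" "Y (m - 3) = 1 - f (m + 2)"
    using m unfolding Y_def by (simp_all add: numeral_eq_Suc Suc_diff_le) 
  have tail: "f s + f (3 * m - s) \<le> 2 * Y s + (Y 0 + Y (m - 2))" if s: "s \<le> m - 2" for s
  proof -
    have e: "s + (2 * m - 1 - s) = 2 * m - 1" "m + 1 + (2 * m - 1 - s) = 3 * m - s"
      using s m by auto
    have le: "s + (2 * m - 1 - s) \<le> n" "m + 1 + (2 * m - 1 - s) \<le> n"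
      unfolding e n by auto
    show ?thesis
      using dens_pair[OF le(1), unfolded e] dens_pair[OF le(2), unfolded e] unfolding Ym unfolding Y_def by argo
  qed
  \<comment> \<open>After scaling by \<open>C m\<close>, the identity \<open>C1\<close> turns the
    coefficient of level \<open>2m + 1\<close> into exactly its weight
    \<open>C (m - 1)\<close>.\<close>
  have cyc: "C m * (f m + f (m - 1)) \<le> C (m - 1) * (1 - f (2 * m + 1))
      + C m * ((1 - f (2 * m)) + Y 0 + Y (m - 2) + Y (m - 3))"
  proof -
    have "real (2 * m + 1) * (f m + f (m - 1)) \<le>
        m * (1 - f (2 * m + 1)) + real (2 * m + 1) * ((1 - f (2 * m)) + Y 0 + Y (m - 2) + Y (m - 3))"
      using dens_cycle[of m] m unfolding Ym n by (simp add: algebra_simps)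
    from mult_left_mono[OF this less_imp_le[OF Cm]]
    have "(2 * real m + 1) * (C m * (f m + f (m - 1))) \<le> (real m * C m) * (1 - f (2 * m + 1)) +
        (2 * real m + 1) * (C m * ((1 - f (2 * m)) + Y 0 + Y (m - 2) + Y (m - 3)))"
      by (simp add: algebra_simps)
    then have "(2 * real m + 1) * (C m * (f m + f (m - 1))) \<le> (2 * real m + 1) * (C (m - 1) * (1 - f (2 * m + 1)) +
        C m * ((1 - f (2 * m)) + Y 0 + Y (m - 2) + Y (m - 3)))"
      unfolding C1 by (simp add: algebra_simps)
    then show ?thesis
      by (simp add: mult_le_cancel_left_pos)
  qed
  have D: "D = (\<Sum>s\<le>m - 2. C (2 * m - 1 - s) * Y s) - (\<Sum>s\<le>m - 2. C s * (f s + f (3 * m - s)))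
      + C m * (1 - f (2 * m)) + C (m - 1) * (1 - f (2 * m + 1)) - C (m - 1) * f (m - 1) - C m * f m"
  proof -
    have "real S = (\<Sum>s\<le>m - 2. C (2 * m - 1 - s)) + (C m + C (m - 1))"
      unfolding S_def of_nat_sum C_def[symmetric] using m sum_split_3m(2)[of m C] sym by simp
    moreover have "real (card \<F>) = (\<Sum>s\<le>m - 2. C s * f s + C (2 * m - 1 - s) * f (2 * m - 1 - s)
        + C s * f (3 * m - s)) + (C (m - 1) * f (m - 1) + C m * f m + C m * f (2 * m) + C (m - 1) * f (2 * m + 1))"
      unfolding card_family C_def[symmetric] using m sum_split_3m(1)[of m "\<lambda>t. C t * f t"] sym by (simp add: n)
    ultimately show ?thesis
      unfolding D_def Y_def by (simp add: sum.distrib sum_subtractf algebra_simps)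
  qed
  have tails: "(\<Sum>s\<le>m - 2. C s * (f s + f (3 * m - s))) \<le> (\<Sum>s\<le>m - 2. C s * (2 * Y s + (Y 0 + Y (m - 2))))"
    by (intro sum_mono mult_left_mono tail) (auto simp: C_def)
  also have "\<dots> = (\<Sum>s\<le>m - 2. 2 * C s * Y s) + \<sigma> * (Y 0 + Y (m - 2))"
    unfolding \<sigma>_def sum_distrib_right sum.distrib[symmetric] by (intro sum.cong) (auto simp: algebra_simps)
  finally have tails: "(\<Sum>s\<le>m - 2. C s * (f s + f (3 * m - s))) \<le> \<dots>" .
  have sum\<kappa>: "(\<Sum>s\<le>m - 2. \<kappa> s * Y s) = (\<Sum>s\<le>m - 2. C (2 * m - 1 - s) * Y s) - (\<Sum>s\<le>m - 2. 2 * C s * Y s)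
      - (\<sigma> + C m) * Y 0 - (\<sigma> + C m) * Y (m - 2) - C m * Y (m - 3)"
    unfolding \<kappa>_def using m diff_le_mono2[of 2 3 m]
    by (simp add: left_diff_distrib sum_subtractf if_distrib[of "\<lambda>x. x * _"] sum.delta cong: if_cong)
  \<comment> \<open>The cyclic inequality pays \<open>C m\<close> for level \<open>m - 1\<close>,
    whose weight is only \<open>C (m - 1)\<close>; the difference is the extra slack.\<close>
  have D_ge: "(\<Sum>s\<le>m - 2. \<kappa> s * Y s) + (C m - C (m - 1)) * f (m - 1) \<le> D"
    using D tails cyc unfolding sum\<kappa> by (simp add: algebra_simps)
  have nonneg: "0 \<le> (\<Sum>s\<le>m - 2. \<kappa> s * Y s)" "0 \<le> (C m - C (m - 1)) * f (m - 1)"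
    using \<kappa> Y0 C1_less by (auto intro!: sum_nonneg mult_nonneg_nonneg simp: less_imp_le)
  show "card \<F> \<le> S"
    using D_ge nonneg unfolding D_def by linarith
  show eq1: "f (m - 1) = 0" if "card \<F> = S"
  proof -
    have "(C m - C (m - 1)) * f (m - 1) = 0"
      using D_ge nonneg that unfolding D_def by linarith
    then show ?thesis
      using C1_less by simp
  qed
  show eq2: "f (2 * m - 1 - s) = 1 \<and> f s = 0 \<and> f (3 * m - s) = 0" if eq: "card \<F> = S" and s: "s \<le> m - 2" for s
  proof -
    have "(\<Sum>s\<le>m - 2. \<kappa> s * Y s) = 0"
      using D_ge nonneg eq unfolding D_def by linarith
    then have "\<kappa> s * Y s = 0" if "s \<le> m - 2" for s
      using \<kappa> Y0 that by (subst (asm) sum_nonneg_eq_0_iff) (auto simp: less_imp_le)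
    then have Y: "Y s = 0" if "s \<le> m - 2" for s
      using \<kappa>[OF that] that by (metis less_irrefl mult_eq_0_iff)
    then have "f s + f (3 * m - s) \<le> 0"
      using tail[OF s] s by simp
    then show ?thesis
      using Y[OF s] f_nonneg[of s] f_nonneg[of "3 * m - s"] unfolding Y_def by linarith
  qed
  show "real (2 * m + 1) * f m = m * (1 - f (2 * m + 1)) + real (2 * m + 1) * (1 - f (2 * m))"
    if eq: "card \<F> = S"
  proof -
    have "C m * f m = C (m - 1) * (1 - f (2 * m + 1)) + C m * (1 - f (2 * m))"
      using D eq1[OF eq] eq2[OF eq] eq unfolding D_def Y_def by simp
    then have "C m * ((2 * real m + 1) * f m) =
       ((2 * real m + 1) * C (m - 1)) * (1 - f (2 * m + 1)) + C m * ((2 * real m + 1) * (1 - f (2 * m)))"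
      by algebra
    then have "C m * ((2 * real m + 1) * f m) =
       C m * (real m * (1 - f (2 * m + 1)) + (2 * real m + 1) * (1 - f (2 * m)))"
      unfolding C1[symmetric] by algebra
    moreover have "real (2 * m + 1) = 2 * real m + 1"
      by simp
    ultimately show ?thesis
      using Cm by (simp only: mult_cancel_left) simp
  qed
qed

text \<open>The same accounting, with the one-point and two-point inequalities in place of the
  cyclic one. They use up the weight of level \<open>m + 1\<close> exactly, so in the equality case
  this level is tied to level \<open>2m + 2\<close> but not determined.\<close>

lemma bound_3m2:
  assumes n: "n = 3 * m + 2" and m: "m \<ge> 6"
  defines "S \<equiv> \<Sum>t = m + 1..2 * m + 1. n choose t"
  shows "card \<F> \<le> S"
    and "card \<F> = S \<Longrightarrow> s \<le> m - 2 \<Longrightarrow> f (2 * m - s) = 1 \<and> f s = 0 \<and> f (3 * m + 2 - s) = 0"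
    and "card \<F> = S \<Longrightarrow> f (2 * m + 1) = 1 \<and> f (m - 1) = 0 \<and> f m = 0 \<and> f (2 * m + 3) = 0"
    and "card \<F> = S \<Longrightarrow> f (2 * m + 2) = 2 * (1 - f (m + 1))"
proof -
  define C where "C t = real (n choose t)" for t
  define Y where "Y s = 1 - f (2 * m - s)" for s
  define y where "y = 1 - f (2 * m + 1)"
  define D where "D = real S - real (card \<F>)"
  define \<sigma> where "\<sigma> = (\<Sum>s\<le>m - 2. C s)"
  define \<sigma>' where "\<sigma>' = (\<Sum>s\<le>m - 2. C (s + 1))"
  define \<kappa> where "\<kappa> s = C (2 * m - s) - C (s + 1) - C s - (if s = 0 then C m / 2 else 0)
      - (if s = m - 2 then \<sigma> + 2 * C m else 0)" for s
  have sym: "C (2 * m + 1) = C (m + 1)" "C (2 * m + 2) = C m" "C (2 * m + 3) = C (m - 1)"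
    "s \<le> 3 * m + 2 \<Longrightarrow> C (3 * m + 2 - s) = C s" for s
    unfolding C_def n using m binomial_symmetric[of "m + 1" "3 * m + 2"] binomial_symmetric[of m "3 * m + 2"]
      binomial_symmetric[of "m - 1" "3 * m + 2"] binomial_symmetric[of s "3 * m + 2"]
    by (simp_all add: numeral_eq_Suc)
  have Cm: "C m > 0"
    by (simp add: C_def n)
  have C1: "real m * C m = (2 * real m + 3) * C (m - 1)"
    using choose_step[of "m - 1" n] m by (simp add: C_def n of_nat_diff)
  have C2: "C (m + 1) = 2 * C m"
  proof -
    have "(real m + 1) * C (m + 1) = (real m + 1) * (2 * C m)"
      using choose_step[of m n] by (simp add: C_def n algebra_simps)
    then show ?thesis
      by (simp only: mult_cancel_left) linarith
  qed
  have C3: "(real m + 2) * C (m + 2) = (2 * real m + 1) * (2 * C m)"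
  proof -
    have "(real (m + 1) + 1) * C (m + 1 + 1) = (real n - real (m + 1)) * C (m + 1)"
      unfolding C_def by (rule choose_step) (simp add: n)
    then show ?thesis
      unfolding C2 by (simp add: n algebra_simps numeral_2_eq_2)
  qed
  have C0: "2 * C (m - 2) \<le> C (m - 1)"
    using choose_double[of "m - 2" n] m by (simp add: C_def n Suc_diff_Suc numeral_2_eq_2)
  have C1_less: "2 * C (m - 1) < C m"
  proof -
    have "C (m - 1) > 0"
      by (simp add: C_def n)
    then have "real m * (2 * C (m - 1)) < (2 * real m + 3) * C (m - 1)"
      by (simp add: algebra_simps)
    then show ?thesis
      unfolding C1[symmetric] using m by (simp add: mult_less_cancel_left_pos)
  qed
  have \<sigma>: "\<sigma> \<le> 2 * C (m - 2)"
    unfolding \<sigma>_def C_def using m by (intro sum_choose_le) (simp add: n)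
  have \<sigma>': "\<sigma>' < C m"
  proof -
    have "\<sigma>' \<le> (\<Sum>s\<le>Suc (m - 2). C s)"
      unfolding \<sigma>'_def sum.atMost_Suc_shift by (simp add: C_def)
    also have "Suc (m - 2) = m - 1"
      using m by simp
    also have "(\<Sum>s\<le>m - 1. C s) \<le> 2 * C (m - 1)"
      unfolding C_def using m by (intro sum_choose_le) (simp add: n)
    finally show ?thesis
      using C1_less by simp
  qed
  \<comment> \<open>The only place where \<open>m \<ge> 6\<close> is really needed: it gives \<open>C (m + 2) \<ge> 13 / 4 * C m\<close>.\<close>
  have key: "C (m + 2) > C (m - 1) + C (m - 2) + \<sigma> + 2 * C m"
  proof -
    have "(real m + 2) * (13 / 4 * C m) \<le> (real m + 2) * C (m + 2)"
      unfolding C3 using mult_right_mono[of 6 "real m" "C m"] m Cm by (simp add: algebra_simps)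
    then have "13 / 4 * C m \<le> C (m + 2)"
      by (simp add: mult_le_cancel_left_pos)
    then show ?thesis
      using \<sigma> C0 C1_less by simp
  qed
  have \<kappa>: "\<kappa> s > 0" if s: "s \<le> m - 2" for s
  proof -
    have a: "C (m + 2) \<le> C (2 * m - s)"
      unfolding C_def of_nat_le_iff using s m by (intro choose_middle) (auto simp: n)
    have b: "C s \<le> C (m - 2)" "C (s + 1) \<le> C (m - 1)"
      unfolding C_def of_nat_le_iff by (rule binomial_mono; use s m n in linarith)+
    have "\<sigma> \<ge> 0"
      unfolding \<sigma>_def C_def by (intro sum_nonneg) simp
    then show ?thesis
      using a b key Cm m unfolding \<kappa>_def by auto
  qed
  have Y0: "Y s \<ge> 0" "y \<ge> 0" for s
    by (simp_all add: Y_def y_def)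
  have Ym: "Y 0 = 1 - f (2 * m)" "Y (m - 2) = 1 - f (m + 2)"
    using m unfolding Y_def by (simp_all add: numeral_eq_Suc Suc_diff_le)
  have low: "f (s + 1) \<le> Y s + y" if s: "s \<le> m - 2" for s
  proof -
    have e: "s + 1 + (2 * m - s) = 2 * m + 1"
      using s m by auto
    have le: "s + 1 + (2 * m - s) \<le> n"
      unfolding e n by auto
    show ?thesis
      using dens_pair[OF le, unfolded e] unfolding y_def Y_def by linarith
  qed
  have high: "f (3 * m + 2 - s) \<le> Y s + Y (m - 2)" if s: "s \<le> m - 2" for s
  proof -
    have e: "m + 2 + (2 * m - s) = 3 * m + 2 - s"
      using s m by auto
    have le: "m + 2 + (2 * m - s) \<le> n"
      unfolding e n by auto
    show ?thesis
      using dens_pair[OF le, unfolded e] unfolding Ym unfolding Y_def by argo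
  qed
  have I1: "f (2 * m + 2) + 2 * f m \<le> 2 * (1 - f (m + 1)) + y + Y 0 + 2 * Y (m - 2)"
    using dens_two_points[of m] n unfolding Ym y_def by simp
  have I2: "f (2 * m + 2) + f (2 * m + 3) \<le> 2 * (1 - f (m + 1)) + 2 * Y (m - 2)"
    using dens_point[of "m + 1"] m unfolding Ym n by (simp add: numeral_eq_Suc)
  \<comment> \<open>Half the sum of \<open>I1\<close> and \<open>I2\<close>, times
    \<open>C m\<close>: level \<open>2m + 2\<close> is paid exactly, and level \<open>2m + 3\<close>
    receives \<open>C m / 2\<close>, more than its weight \<open>C (m - 1)\<close>.\<close>
  have main: "C m * f (2 * m + 2) + C m * f m + C m / 2 * f (2 * m + 3) \<le>
      2 * C m * (1 - f (m + 1)) + C m / 2 * y + C m / 2 * Y 0 + 2 * C m * Y (m - 2)"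
    using mult_left_mono[OF add_mono[OF I1 I2], of "C m / 2"] Cm by (simp add: algebra_simps)
  \<comment> \<open>Reindexing by \<open>s + 1\<close> brings level \<open>m - 1\<close> into the
    sum; level 0 drops out because \<open>f 0 = 0\<close>.\<close>
  have shift: "(\<Sum>s\<le>m - 2. C s * f s) + C (m - 1) * f (m - 1) = (\<Sum>s\<le>m - 2. C (s + 1) * f (s + 1))"
  proof -
    have "(\<Sum>s\<le>Suc (m - 2). C s * f s) = C 0 * f 0 + (\<Sum>s\<le>m - 2. C (s + 1) * f (s + 1))"
      unfolding sum.atMost_Suc_shift by simp
    moreover have "Suc (m - 2) = m - 1"
      using m by simp
    ultimately show ?thesis
      using f_0 sum.atMost_Suc[of "\<lambda>s. C s * f s" "m - 2"] by simp
  qed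
  have D: "D = (\<Sum>s\<le>m - 2. C (2 * m - s) * Y s) - (\<Sum>s\<le>m - 2. C (s + 1) * f (s + 1))
      - (\<Sum>s\<le>m - 2. C s * f (3 * m + 2 - s)) + 2 * C m * (1 - f (m + 1)) + 2 * C m * y
      - C m * f m - C m * f (2 * m + 2) - C (m - 1) * f (2 * m + 3)"
  proof -
    have "real S = (\<Sum>s\<le>m - 2. C (2 * m - s)) + (C (m + 1) + C (m + 1))"
      unfolding S_def of_nat_sum C_def[symmetric] using m sum_split_3m2(2)[of m C] sym by simp
    moreover have "real (card \<F>) = (\<Sum>s\<le>m - 2. C s * f s + C (2 * m - s) * f (2 * m - s)
        + C s * f (3 * m + 2 - s)) + (C (m - 1) * f (m - 1) + C m * f m + C (m + 1) * f (m + 1)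
        + C (m + 1) * f (2 * m + 1) + C m * f (2 * m + 2) + C (m - 1) * f (2 * m + 3))"
      unfolding card_family C_def[symmetric] using m sum_split_3m2(1)[of m "\<lambda>t. C t * f t"] sym by (simp add: n)
    ultimately show ?thesis
      unfolding D_def Y_def y_def shift[symmetric] C2 by (simp add: sum.distrib sum_subtractf algebra_simps)
  qed
  have "(\<Sum>s\<le>m - 2. C (s + 1) * f (s + 1)) \<le> (\<Sum>s\<le>m - 2. C (s + 1) * (Y s + y))"
    by (intro sum_mono mult_left_mono low) (auto simp: C_def)
  also have "\<dots> = (\<Sum>s\<le>m - 2. C (s + 1) * Y s) + \<sigma>' * y"
    unfolding \<sigma>'_def sum_distrib_right sum.distrib[symmetric] by (simp add: algebra_simps)
  finally have lows: "(\<Sum>s\<le>m - 2. C (s + 1) * f (s + 1)) \<le> \<dots>" .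
  have "(\<Sum>s\<le>m - 2. C s * f (3 * m + 2 - s)) \<le> (\<Sum>s\<le>m - 2. C s * (Y s + Y (m - 2)))"
    by (intro sum_mono mult_left_mono high) (auto simp: C_def)
  also have "\<dots> = (\<Sum>s\<le>m - 2. C s * Y s) + \<sigma> * Y (m - 2)"
    unfolding \<sigma>_def sum_distrib_right sum.distrib[symmetric] by (simp add: algebra_simps)
  finally have highs: "(\<Sum>s\<le>m - 2. C s * f (3 * m + 2 - s)) \<le> \<dots>" .
  have sum\<kappa>: "(\<Sum>s\<le>m - 2. \<kappa> s * Y s) = (\<Sum>s\<le>m - 2. C (2 * m - s) * Y s) - (\<Sum>s\<le>m - 2. C (s + 1) * Y s)
      - (\<Sum>s\<le>m - 2. C s * Y s) - C m / 2 * Y 0 - (\<sigma> + 2 * C m) * Y (m - 2)"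
    unfolding \<kappa>_def using m
    by (simp add: left_diff_distrib sum_subtractf if_distrib[of "\<lambda>x. x * _"] sum.delta cong: if_cong)
  have D_ge: "(\<Sum>s\<le>m - 2. \<kappa> s * Y s) + (3 / 2 * C m - \<sigma>') * y + (C m / 2 - C (m - 1)) * f (2 * m + 3) \<le> D"
    using D lows highs main unfolding sum\<kappa> by (simp add: algebra_simps)
  have pos: "3 / 2 * C m - \<sigma>' > 0" "C m / 2 - C (m - 1) > 0"
    using \<sigma>' C1_less Cm by auto
  have nonneg: "0 \<le> (\<Sum>s\<le>m - 2. \<kappa> s * Y s)" "0 \<le> (3 / 2 * C m - \<sigma>') * y"
    "0 \<le> (C m / 2 - C (m - 1)) * f (2 * m + 3)"
    using \<kappa> Y0 pos by (auto intro!: sum_nonneg mult_nonneg_nonneg simp: less_imp_le)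
  show "card \<F> \<le> S"
    using D_ge nonneg unfolding D_def by linarith
  assume eq: "card \<F> = S"
  have zero: "(\<Sum>s\<le>m - 2. \<kappa> s * Y s) = 0" "y = 0" "f (2 * m + 3) = 0"
  proof -
    have "(3 / 2 * C m - \<sigma>') * y = 0" "(C m / 2 - C (m - 1)) * f (2 * m + 3) = 0"
      and "(\<Sum>s\<le>m - 2. \<kappa> s * Y s) = 0"
      using D_ge nonneg eq unfolding D_def by linarith+
    then show "(\<Sum>s\<le>m - 2. \<kappa> s * Y s) = 0" "y = 0" "f (2 * m + 3) = 0"
      using pos by (metis less_irrefl mult_eq_0_iff)+
  qed
  then have "\<kappa> s * Y s = 0" if "s \<le> m - 2" for s
    using \<kappa> Y0 that by (subst (asm) sum_nonneg_eq_0_iff) (auto simp: less_imp_le)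
  then have Y: "Y s = 0" if "s \<le> m - 2" for s
    using \<kappa>[OF that] that by (metis less_irrefl mult_eq_0_iff)
  have f_low: "f (s + 1) = 0" if "s \<le> m - 2" for s
    using low[OF that] Y[OF that] zero(2) f_nonneg[of "s + 1"] by linarith
  have f_high: "f (3 * m + 2 - s) = 0" if "s \<le> m - 2" for s
    using high[OF that] Y[OF that] Y[OF order_refl] f_nonneg[of "3 * m + 2 - s"] by argo
  show "f (2 * m - s) = 1 \<and> f s = 0 \<and> f (3 * m + 2 - s) = 0" if s: "s \<le> m - 2" for s
    using Y[OF s] f_high[OF s] f_low[of "s - 1"] f_0 s unfolding Y_def by (cases s) auto
  have "C m * (2 * (1 - f (m + 1))) = C m * (f m + f (2 * m + 2))"
    using D eq Y zero f_low f_high unfolding D_def by (simp add: algebra_simps)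
  then have tot: "f m + f (2 * m + 2) = 2 * (1 - f (m + 1))"
    using Cm by simp
  \<comment> \<open>\<open>I1\<close> bounds \<open>f (2 * m + 2) + 2 * f m\<close> by the value
    that \<open>tot\<close> gives to the sum with \<open>f m\<close> counted once.\<close>
  then have fm: "f m = 0"
    using I1 Y[OF order_refl] Y[OF le0] zero(2) f_nonneg[of m] by argo
  then show "f (2 * m + 2) = 2 * (1 - f (m + 1))"
    using tot by simp
  show "f (2 * m + 1) = 1 \<and> f (m - 1) = 0 \<and> f m = 0 \<and> f (2 * m + 3) = 0"
  proof -
    have "m - 2 + 1 = m - 1"
      using m by simp
    then show ?thesis
      using fm zero(2,3) f_low[OF order_refl] unfolding y_def by simp
  qed
qed

section \<open>The extremal families for \<open>n = 3m + 2\<close>\<close>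

text \<open>Some permutation carries two consecutive intervals to \<open>A\<close> and
  \<open>B\<close>, and \<open>average_eq\<close> applies to it.\<close>

lemma local_pair_eq:
  assumes eq: "f s + f t + f (s + t) = 2"
    and AB: "A \<subseteq> {1..n}" "B \<subseteq> {1..n}" "A \<inter> B = {}" "card A = s" "card B = t"
  shows "of_bool (A \<in> \<F>) + of_bool (B \<in> \<F>) + of_bool (A \<union> B \<in> \<F>) = (2 :: real)"
proof -
  have fin: "finite A" "finite B"
    using finite_subset[OF AB(1)] finite_subset[OF AB(2)] by auto
  obtain g where g: "bij_betw g {1..s} A"
    using finite_same_card_bij[of "{1..s}" A] AB(4) fin(1) by auto
  obtain h where h: "bij_betw h {s+1..s+t} B"
    using finite_same_card_bij[of "{s+1..s+t}" B] AB(5) fin(2) by auto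
  define e where "e x = (if x \<le> s then g x else h x)" for x
  have 1: "bij_betw e {1..s} A"
    using g by (subst bij_betw_cong[where g = g]) (auto simp: e_def)
  have 2: "bij_betw e {s+1..s+t} B"
    using h by (subst bij_betw_cong[where g = h]) (auto simp: e_def)
  have u: "{1..s} \<union> {s+1..s+t} = {1..s+t}" "{1..s} \<inter> {s+1..s+t} = {}"
    by auto
  have 3: "bij_betw e {1..s+t} (A \<union> B)"
    using bij_betw_combine[OF 1 2 AB(3)] unfolding u(1) .
  have st: "s + t \<le> n"
    using card_mono[of "{1..n}" "A \<union> B"] AB fin by (simp add: card_Un_disjoint)
  obtain \<pi> where \<pi>: "\<pi> permutes {1..n}" "\<And>x. x \<in> {1..s+t} \<Longrightarrow> \<pi> x = e x"
  proof (rule permutes_extend[of "{1..n}" "{1..s+t}" e])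
    show "{1..s+t} \<subseteq> {1..n}" using st by auto
    show "inj_on e {1..s+t}" "e ` {1..s+t} \<subseteq> {1..n}"
      using 3 AB by (auto simp: bij_betw_def)
  qed auto
  have im: "\<pi> ` X = e ` X" if "X \<subseteq> {1..s+t}" for X
    using \<pi>(2) that by (intro image_cong) auto
  let ?L = "[(1::real, {1..s}), (1, {s+1..s+t}), (1, {1..s+t})]"
  have "(\<Sum>(c, X)\<leftarrow>?L. c * of_bool (\<pi> ` X \<in> \<F>)) = 2"
  proof (rule average_eq[OF _ _ _ \<pi>(1)])
    fix \<pi> assume "\<pi> permutes {1..n}"
    from local_pair[OF pullback[OF this] u(2)]
    show "(\<Sum>(c, X)\<leftarrow>?L. c * of_bool (\<pi> ` X \<in> \<F>)) \<le> 2"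
      unfolding u(1) by simp
  qed (use st eq in auto)
  moreover have "\<pi> ` {1..s} = A" "\<pi> ` {s+1..s+t} = B" "\<pi> ` {1..s+t} = A \<union> B"
    using 1 2 3 by (subst im; auto simp: bij_betw_def)+
  ultimately show ?thesis
    by simp
qed

text \<open>Only levels \<open>m + 1\<close> and \<open>2m + 2\<close> are open, and their relation
  makes the pair inequality for two \<open>(m + 1)\<close>-sets tight: of disjoint \<open>E\<close>,
  \<open>P\<close> and their union exactly one is missing. Hence the star lemma applies to the
  missing \<open>(m + 1)\<close>-sets.\<close>

lemma extremal_3m2:
  assumes n: "n = 3 * m + 2" and m: "m \<ge> 6"
    and eq: "card \<F> = (\<Sum>t = m + 1..2 * m + 1. n choose t)"
  shows "\<F> = K_family (3 * m + 2) \<or>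
    (\<exists>q\<in>{1..n}. \<F> = {A. A \<subseteq> {1..n} \<and> m + 1 \<le> card (A - {q}) \<and> card (A - {q}) \<le> 2 * m + 1})"
proof -
  let ?V = "{1..n}"
  define Y where "Y = {E. E \<subseteq> ?V \<and> card E = m + 1 \<and> E \<notin> \<F>}"
  have mid: "f t = 1" if "m + 2 \<le> t" "t \<le> 2 * m + 1" for t
    using bound_3m2(2)[OF n m eq, of "2 * m - t"] bound_3m2(3)[OF n m eq] that
    by (cases "t = 2 * m + 1") auto
  have low: "f t = 0" if "t \<le> m" for t
    using bound_3m2(2)[OF n m eq, of t] bound_3m2(3)[OF n m eq] that
    by (cases "t = m"; cases "t = m - 1") auto
  have high: "f t = 0" if "t \<ge> 2 * m + 3" "t \<le> n" for t
    using bound_3m2(2)[OF n m eq, of "3 * m + 2 - t"] bound_3m2(3)[OF n m eq] that n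
    by (cases "t = 2 * m + 3") auto
  have split: "of_bool (E \<in> \<F>) + of_bool (P \<in> \<F>) + of_bool (E \<union> P \<in> \<F>) = (2 :: real)"
    if "E \<subseteq> ?V" "P \<subseteq> ?V" "E \<inter> P = {}" "card E = m + 1" "card P = m + 1" for E P
  proof (rule local_pair_eq[OF _ that])
    have e: "m + 1 + (m + 1) = 2 * m + 2"
      by simp
    show "f (m + 1) + f (m + 1) + f (m + 1 + (m + 1)) = 2"
      unfolding e using bound_3m2(4)[OF n m eq] by simp
  qed
  have fin: "finite A" if "A \<subseteq> ?V" for A
    using that by (rule finite_subset) simp
  have mem: "A \<in> \<F> \<longleftrightarrow> (m + 2 \<le> card A \<and> card A \<le> 2 * m + 1) \<or> (card A = m + 1 \<and> A \<notin> Y) \<or>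
      (card A = 2 * m + 2 \<and> A \<in> \<F>)" if A: "A \<subseteq> ?V" for A
  proof -
    have "card A \<le> n"
      using card_mono[OF _ A] by simp
    then consider "card A \<le> m" | "card A = m + 1" | "m + 2 \<le> card A" "card A \<le> 2 * m + 1"
      | "card A = 2 * m + 2" | "2 * m + 3 \<le> card A" "card A \<le> n"
      by linarith
    then show ?thesis
    proof cases
      case 1
      then show ?thesis using level_empty[OF low[OF 1]] by auto
    next
      case 2
      then show ?thesis using A by (simp add: Y_def)
    next
      case 3
      then show ?thesis using level_full[OF mid[OF 3] A] by simp
    next
      case 5
      then show ?thesis using level_empty[OF high[OF 5]] by auto
    qed simp
  qed
  have halve: "\<exists>E P. A = E \<union> P \<and> E \<inter> P = {} \<and> x \<in> E \<and> card E = m + 1 \<and> card P = m + 1"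
    if A: "A \<subseteq> ?V" "card A = 2 * m + 2" "x \<in> A" for A x
  proof -
    have "m \<le> card (A - {x})"
      using A fin by simp
    then obtain R where R: "R \<subseteq> A - {x}" "card R = m" "finite R"
      by (rule obtain_subset_with_card_n)
    have "card (insert x R) = m + 1"
      using R by (subst card_insert_disjoint) auto
    moreover have "card (A - insert x R) = m + 1"
      using R A calculation by (subst card_Diff_subset) auto
    ultimately show ?thesis
      using R A by (intro exI[of _ "insert x R"] exI[of _ "A - insert x R"]) auto
  qed
  have K: "(3 * m + 2) div 3 = m"
    by simp
  show ?thesis
  proof (cases "Y = {}")
    case True
    have top: "A \<notin> \<F>" if A: "A \<subseteq> ?V" "card A = 2 * m + 2" for A
    proof -
      obtain x where x: "x \<in> A"
        using A(2) by (metis card.empty ex_in_conv zero_neq_numeral add_is_0)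
      obtain E P where E: "A = E \<union> P" "E \<inter> P = {}" "card E = m + 1" "card P = m + 1"
        using halve[OF A x] by blast
      then have "E \<in> \<F>" "P \<in> \<F>"
        using True A unfolding Y_def by auto
      then show ?thesis
        using partition_freeD[OF pf] E by blast
    qed
    have "A \<in> \<F> \<longleftrightarrow> A \<subseteq> ?V \<and> m + 1 \<le> card A \<and> card A \<le> 2 * m + 1" for A
    proof (cases "A \<subseteq> ?V")
      case A: True
      have "A \<in> \<F> \<longleftrightarrow> m + 2 \<le> card A \<and> card A \<le> 2 * m + 1 \<or> card A = m + 1"
        using mem[OF A] top[OF A] True by blast
      then show ?thesis
        using A by linarith
    next
      case False
      then show ?thesis
        using sub by blast
    qed
    then have "\<F> = {A. A \<subseteq> ?V \<and> m + 1 \<le> card A \<and> card A \<le> 2 * m + 1}"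
      by (intro set_eqI) (simp only: mem_Collect_eq)
    then show ?thesis
      unfolding K_family_def K n by (rule disjI1)
  next
    case False
    have "\<exists>q\<in>?V. Y = {E. E \<subseteq> ?V \<and> card E = m + 1 \<and> q \<in> E}"
    proof (rule star_of_exchange)
      show "E \<inter> P \<noteq> {}" if "E \<in> Y" "P \<in> Y" for E P
        using split[of E P] that unfolding Y_def by (auto simp: of_bool_def split: if_splits)
      fix E P q u
      assume E: "E \<in> Y" and P: "P \<subseteq> ?V" "card P = m + 1" and EP: "E \<inter> P = {q}" and u: "u \<in> ?V - E - P"
      have finE: "finite E" "finite P"
        using E P fin unfolding Y_def by auto
      have qEP: "q \<in> E" "q \<in> P"
        using EP by blast+
      let ?E = "insert u (E - {q})" and ?P = "insert u (P - {q})"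
      have cE: "card ?E = m + 1" and cP: "card ?P = m + 1"
        using E P qEP u finE unfolding Y_def by (auto simp: card_insert_if)
      \<comment> \<open>One \<open>(2m + 2)\<close>-set is halved in two ways. As \<open>E\<close>
        is missing, the union is present, so the second halving has a missing half.\<close>
      have "E \<union> ?P = ?E \<union> P" "E \<inter> ?P = {}" "?E \<inter> P = {}"
        using EP u by auto
      moreover have "?E \<subseteq> ?V" "?P \<subseteq> ?V" "E \<subseteq> ?V" "card E = m + 1" "E \<notin> \<F>"
        using E P u unfolding Y_def by auto
      ultimately show "P \<in> Y \<or> ?E \<in> Y"
        using split[of E ?P] split[of ?E P] P cE cP unfolding Y_def mem_Collect_eq
        by (cases "?E \<in> \<F>"; cases "P \<in> \<F>"; cases "?P \<in> \<F>"; cases "?E \<union> P \<in> \<F>") simp_all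
    qed (use False n m in \<open>auto simp: Y_def\<close>)
    then obtain q where q: "q \<in> ?V" and Yq: "Y = {E. E \<subseteq> ?V \<and> card E = m + 1 \<and> q \<in> E}"
      by blast
    \<comment> \<open>A half is missing exactly when it contains \<open>q\<close>, and one of the
      two halves and \<open>A\<close> is missing.\<close>
    have top: "A \<in> \<F> \<longleftrightarrow> q \<in> A" if A: "A \<subseteq> ?V" "card A = 2 * m + 2" for A
    proof -
      obtain x where x: "x \<in> A" "q \<in> A \<longrightarrow> x = q"
        using A by (cases "q \<in> A") fastforce+
      obtain E P where E: "A = E \<union> P" "E \<inter> P = {}" "x \<in> E" "card E = m + 1" "card P = m + 1"
        using halve[OF A x(1)] by blast
      have "E \<in> \<F> \<longleftrightarrow> q \<notin> E" "P \<in> \<F> \<longleftrightarrow> q \<notin> P"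
        using mem[of E] mem[of P] E A Yq by auto
      then show ?thesis
        using split[of E P] E A x by (auto simp: of_bool_def split: if_splits)
    qed
    have "A \<in> \<F> \<longleftrightarrow> A \<subseteq> ?V \<and> m + 1 \<le> card (A - {q}) \<and> card (A - {q}) \<le> 2 * m + 1" for A
    proof (cases "A \<subseteq> ?V")
      case True
      have mm: "A \<in> \<F> \<longleftrightarrow> m + 2 \<le> card A \<and> card A \<le> 2 * m + 1 \<or> card A = m + 1 \<and> q \<notin> A \<or>
          card A = 2 * m + 2 \<and> q \<in> A"
        using mem[OF True] top[OF True] True unfolding Yq mem_Collect_eq by blast
      \<comment> \<open>Sizes \<open>m + 2\<close> to \<open>2m + 2\<close> for sets through
        \<open>q\<close> and \<open>m + 1\<close> to \<open>2m + 1\<close> for the others are the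
        same window once \<open>q\<close> is deleted.\<close>
      obtain j where j: "card (A - {q}) = j"
        by blast
      have "card A = (if q \<in> A then j + 1 else j)"
        using card.remove[OF fin[OF True], of q] j by (cases "q \<in> A") simp_all
      then show ?thesis
        unfolding j using mm True j by (cases "q \<in> A") (simp_all, linarith+)
    qed (use sub in auto)
    then show ?thesis
      using q by blast
  qed
qed

end

text \<open>Swap \<open>q\<close> with the last point: deleting that point amounts to intersecting
  with \<open>{1..3 * m + 1}\<close>, and \<open>(3 * m + 1) div 3 = m\<close> gives the same
  window.\<close>

lemma image_double_family:
  assumes q: "q \<in> {1..3 * m + 2}"
    and F: "\<F> = {A. A \<subseteq> {1..3 * m + 2} \<and> m + 1 \<le> card (A - {q}) \<and> card (A - {q}) \<le> 2 * m + 1}"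
  shows "\<exists>\<pi>. \<pi> permutes {1..3 * m + 2} \<and> (`) \<pi> ` \<F> = double_family (3 * m + 1) (K_family (3 * m + 1))"
proof -
  let ?V = "{1..3 * m + 2}"
  define z where "z = 3 * m + 2"
  define \<pi> where "\<pi> = transpose q z"
  have \<pi>: "\<pi> permutes ?V"
    unfolding \<pi>_def z_def by (rule permutes_swap_id) (use q in auto)
  have inv: "\<pi> ` \<pi> ` A = A" for A
    by (simp add: \<pi>_def image_comp)
  have sub: "\<pi> ` A \<subseteq> ?V \<longleftrightarrow> A \<subseteq> ?V" for A
  proof -
    have "\<pi> ` B \<subseteq> ?V" if "B \<subseteq> ?V" for B
      using image_mono[OF that, of \<pi>] permutes_image[OF \<pi>] by simp
    from this[of A] this[of "\<pi> ` A"] show ?thesis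
      unfolding inv by blast
  qed
  have card: "card (\<pi> ` A - {z}) = card (A - {q})" for A
  proof -
    have "\<pi> ` A - {z} = \<pi> ` (A - {q})"
      unfolding image_set_diff[OF permutes_inj[OF \<pi>]] by (simp add: \<pi>_def)
    then show ?thesis
      using permutes_inj_on[OF \<pi>] by (simp add: card_image)
  qed
  have dbl: "double_family (3 * m + 1) (K_family (3 * m + 1)) =
      {A. A \<subseteq> ?V \<and> m + 1 \<le> card (A - {z}) \<and> card (A - {z}) \<le> 2 * m + 1}"
  proof -
    have "A \<inter> {1..3 * m + 1} = A - {z}" if "A \<subseteq> ?V" for A
      using that by (auto simp: z_def subset_iff)
    then show ?thesis
      unfolding double_family_def K_family_def by auto
  qed
  have "B \<in> (`) \<pi> ` \<F> \<longleftrightarrow> B \<in> double_family (3 * m + 1) (K_family (3 * m + 1))" for B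
  proof -
    have "B \<in> (`) \<pi> ` \<F> \<longleftrightarrow> \<pi> ` B \<in> \<F>"
      using inv by (metis image_eqI image_iff)
    also have "\<dots> \<longleftrightarrow> B \<subseteq> ?V \<and> m + 1 \<le> card (B - {z}) \<and> card (B - {z}) \<le> 2 * m + 1"
      unfolding F using sub[of B] card[of "\<pi> ` B"] by (simp add: inv)
    finally show ?thesis
      unfolding dbl by simp
  qed
  then show ?thesis
    using \<pi> by blast
qed

section \<open>The extremal families for \<open>n = 3m\<close>\<close>

lemma image_nth_interval:
  assumes "i \<le> j" "j \<le> length xs"
  shows "(!) xs ` {i..<j} = set (take (j - i) (drop i xs))"
proof -
  have "{i..<j} = (+) i ` {0..<j - i}"
    using assms by simp
  then have "(!) xs ` {i..<j} = (!) (drop i xs) ` {0..<j - i}"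
    using assms by (simp only: image_image) (intro image_cong, auto)
  then show ?thesis
    using nth_image[of "j - i" "drop i xs"] assms by (simp only: length_drop diff_le_mono)
qed

lemma arc_interval: "i + k \<le> N \<Longrightarrow> arc N i k = {i..<i + k}"
proof -
  assume "i + k \<le> N"
  then have "arc N i k = (+) i ` {..<k}"
    unfolding arc_def by (intro image_cong) auto
  then show ?thesis
    by (simp add: lessThan_atLeast0 add.commute)
qed

text \<open>Isolates what equality supplies: \<open>cyc\<close> is the tight cyclic inequality after
  the terms of the levels known to be full or empty have been evaluated.\<close>

locale cyclic_extremal = partition_free_family +
  fixes m :: nat
  assumes n: "n = 3 * m" and m: "m \<ge> 3"
    and next_level: "A \<subseteq> {1..n} \<Longrightarrow> card A = m + 1 \<Longrightarrow> A \<in> \<F>"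
    and cyc: "distinct xs \<Longrightarrow> length xs = 2 * m + 1 \<Longrightarrow> set xs \<subseteq> {1..n} \<Longrightarrow>
      (\<Sum>i<2 * m + 1. of_bool ((!) xs ` arc (2 * m + 1) i m \<in> \<F>)) =
      real m * of_bool (set xs \<notin> \<F>) + (\<Sum>i<2 * m + 1. of_bool ((!) xs ` arc (2 * m + 1) i (2 * m) \<notin> \<F>))"
begin

abbreviation img :: "nat list \<Rightarrow> nat \<Rightarrow> nat \<Rightarrow> nat set" where
  "img xs i k \<equiv> (!) xs ` arc (2 * m + 1) i k"

lemma img_full: "length xs = 2 * m + 1 \<Longrightarrow> img xs i (2 * m + 1) = set xs"
  using nth_image[of "2 * m + 1" xs] by (simp add: arc_full lessThan_atLeast0)

lemma img_Un: "img xs i k \<union> img xs (i + k) l = img xs i (k + l)"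
  by (simp only: image_Un[symmetric] arc_Un)

lemma img_subset: "length xs = 2 * m + 1 \<Longrightarrow> img xs i k \<subseteq> set xs"
proof -
  assume l: "length xs = 2 * m + 1"
  have "arc (2 * m + 1) i k \<subseteq> {..<2 * m + 1}"
    by (rule arc_subset) simp
  then show ?thesis
    using l by (auto simp: subset_iff)
qed

lemma img_card: "distinct xs \<Longrightarrow> length xs = 2 * m + 1 \<Longrightarrow> k \<le> 2 * m + 1 \<Longrightarrow> card (img xs i k) = k"
proof -
  assume a: "distinct xs" "length xs = 2 * m + 1" "k \<le> 2 * m + 1"
  have "inj_on ((!) xs) (arc (2 * m + 1) i k)"
    using a arc_subset[of "2 * m + 1" i k] by (intro inj_on_nth) auto
  then show ?thesis
    using a by (simp add: card_image card_arc)
qed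

lemma img_disjoint:
  assumes "distinct xs" "length xs = 2 * m + 1" "k + l \<le> 2 * m + 1"
  shows "img xs i k \<inter> img xs (i + k) l = {}"
proof -
  have "arc (2 * m + 1) j k \<subseteq> {..<2 * m + 1}" for j k
    by (rule arc_subset) simp
  moreover have "inj_on ((!) xs) {..<2 * m + 1}"
    using assms by (intro inj_on_nth) auto
  ultimately have "img xs i k \<inter> img xs (i + k) l = (!) xs ` (arc (2 * m + 1) i k \<inter> arc (2 * m + 1) (i + k) l)"
    by (metis inj_on_image_Int)
  then show ?thesis
    using arc_disjoint[OF assms(3)] by simp
qed

lemma img_free:
  assumes "distinct xs" "length xs = 2 * m + 1" "k + l \<le> 2 * m + 1"
    and "img xs i k \<in> \<F>" "img xs (i + k) l \<in> \<F>"
  shows "img xs i (k + l) \<notin> \<F>"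
  using partition_freeD[OF pf assms(4,5) img_disjoint[OF assms(1-3)]] unfolding img_Un .

text \<open>The complementary arc of length \<open>m + 1\<close> is present by
  \<open>next_level\<close>.\<close>

lemma big_notin:
  assumes xs: "distinct xs" "length xs = 2 * m + 1" "set xs \<subseteq> {1..n}" and A: "img xs i m \<in> \<F>"
  shows "set xs \<notin> \<F>"
proof -
  have e: "m + (m + 1) = 2 * m + 1"
    by simp
  have "img xs (i + m) (m + 1) \<in> \<F>"
    using order_trans[OF img_subset[OF xs(2)] xs(3)] img_card[OF xs(1,2)] by (intro next_level) simp_all
  from img_free[OF xs(1,2) _ A this] show ?thesis
    unfolding e img_full[OF xs(2)] by simp
qed

lemma sum_pairs:
  fixes g :: "nat \<Rightarrow> real"
  shows "(\<Sum>i<2 * m + 1. g i) = g m + (\<Sum>i<m. g i) + (\<Sum>i<m. g (i + m + 1))"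
proof -
  have 1: "{..<2 * m + 1} = insert m ({..<m} \<union> {m + 1..<2 * m + 1})"
    by auto
  have 2: "sum g {m + 1..<2 * m + 1} = (\<Sum>i<m. g (i + m + 1))"
    by (rule sum.reindex_bij_witness[where i = "\<lambda>i. i + m + 1" and j = "\<lambda>i. i - m - 1"]) auto
  have 3: "sum g ({..<m} \<union> {m + 1..<2 * m + 1}) = sum g {..<m} + sum g {m + 1..<2 * m + 1}"
    by (rule sum.union_disjoint) auto
  have "sum g {..<2 * m + 1} = g m + sum g ({..<m} \<union> {m + 1..<2 * m + 1})"
    unfolding 1 by (rule sum.insert) auto
  then show ?thesis
    unfolding 2 3 by (simp only: add.assoc)
qed

text \<open>Pair the arc starting at \<open>i < m\<close> with the one starting at \<open>i + m + 1\<close>: they are disjoint and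
  miss one point, so they are both members only if their union is missing. If the conclusion failed,
  the pair \<open>i = 1\<close> and the unpaired arc at \<open>m\<close> would contribute nothing, and the cyclic equation
  would be short by one.\<close>

lemma exchange_arcs:
  assumes d: "distinct (a # as @ [u, v] @ ps @ [z])" and V: "set (a # as @ [u, v] @ ps @ [z]) \<subseteq> {1..n}"
    and l: "length as = m - 1" "length ps = m - 2"
    and A: "set (a # as) \<in> \<F>"
  shows "insert u (set as) \<in> \<F> \<or> insert a (insert z (set ps)) \<in> \<F> \<or> {u, v} \<union> set ps \<in> \<F>"
proof (rule ccontr)
  assume no: "\<not> ?thesis"
  define xs where "xs = a # as @ [u, v] @ ps @ [z]"
  have xs: "distinct xs" "length xs = 2 * m + 1" "set xs \<subseteq> {1..n}"
    using d V l m by (auto simp: xs_def)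
  define h :: "nat \<Rightarrow> real" where "h i = of_bool (img xs i m \<in> \<F>)" for i
  define c :: "nat \<Rightarrow> real" where "c i = of_bool (img xs i (2 * m) \<notin> \<F>)" for i
  have img: "img xs i k = set (take k (drop i xs))" if "i + k \<le> 2 * m + 1" for i k
    using image_nth_interval[of i "i + k" xs] that xs(2) by (simp add: arc_interval)
  obtain k where k: "m = Suc (Suc k)"
    using that[of "m - 2"] m by simp
  have i0: "img xs 0 m = set (a # as)"
    using l k by (subst img) (simp_all add: xs_def)
  have i1: "img xs 1 m = insert u (set as)"
    using l k by (subst img) (simp_all add: xs_def)
  have im: "img xs m m = {u, v} \<union> set ps"
    using l k by (subst img) (simp_all add: xs_def)
  \<comment> \<open>This arc wraps around the end of the list, and its last point is position 0,
    that is, \<open>a\<close>.\<close>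
  have im2: "img xs (m + 2) m = insert a (insert z (set ps))"
  proof -
    have "img xs (m + 2) m = img xs (m + 2) (m - 1) \<union> img xs (m + 2 + (m - 1)) 1"
      unfolding img_Un using m by simp
    also have "m + 2 + (m - 1) = 0 + (2 * m + 1)"
      using m by simp
    also have "img xs (0 + (2 * m + 1)) 1 = img xs 0 1"
      using arc_mod[of "2 * m + 1" "0 + (2 * m + 1)" 1] by (metis arc_mod mod_add_self2)
    also have "img xs 0 1 = {a}"
      by (subst img) (simp_all add: xs_def)
    also have "img xs (m + 2) (m - 1) = insert z (set ps)"
      using l k by (subst img) (simp_all add: xs_def)
    finally show ?thesis by auto
  qed
  have h01: "h i \<le> 1" "c i \<ge> 0" for i
    by (simp_all add: h_def c_def)
  have zero: "h 1 = 0" "h m = 0" "h (m + 2) = 0"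
    using no unfolding h_def i1 im im2 by auto
  have "set xs \<notin> \<F>"
    using big_notin[OF xs, of 0] A i0 by simp
  then have eq: "(\<Sum>i<2 * m + 1. h i) = m + (\<Sum>i<2 * m + 1. c i)"
    using cyc[OF xs] unfolding h_def c_def by simp
  \<comment> \<open>The arc starting at \<open>i + m + 1\<close> is followed by the one starting at
    \<open>i + 2m + 1\<close>, which is \<open>i\<close> again; together they form a
    \<open>2m\<close>-arc.\<close>
  have pair: "h i + h (i + m + 1) \<le> of_bool (i \<noteq> 1) + c (i + m + 1)" for i
  proof (cases "i = 1")
    case True
    then show ?thesis
      using zero h01(2)[of "1 + m + 1"] by simp
  next
    case False
    have "img xs (i + m + 1 + m) m = img xs i m"
    proof -
      have "i + m + 1 + m = i + (2 * m + 1)"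
        by simp
      then show ?thesis
        by (metis arc_mod mod_add_self2)
    qed
    then have "img xs (i + m + 1) m \<in> \<F> \<Longrightarrow> img xs i m \<in> \<F> \<Longrightarrow> img xs (i + m + 1) (2 * m) \<notin> \<F>"
      using img_free[OF xs(1,2), of m m "i + m + 1"] by (simp add: mult_2)
    then show ?thesis
      using False by (auto simp: h_def c_def)
  qed
  have "(\<Sum>i<m. h i + h (i + m + 1)) \<le> (\<Sum>i<m. of_bool (i \<noteq> 1) + c (i + m + 1))"
    by (intro sum_mono pair)
  moreover have "(\<Sum>i<m. of_bool (i \<noteq> 1) :: real) = m - 1"
  proof -
    have "(\<Sum>i<m. of_bool (i \<noteq> 1) :: real) = (\<Sum>i\<in>{..<m} - {1}. 1)"
      by (rule sum.mono_neutral_cong_right) auto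
    then show ?thesis
      using m by (simp add: of_nat_diff)
  qed
  moreover have "(\<Sum>i<m. c (i + m + 1)) \<le> (\<Sum>i<2 * m + 1. c i)"
    unfolding sum_pairs using h01 by (simp add: sum_nonneg)
  ultimately show False
    using eq zero m unfolding sum_pairs[of h] by (simp add: sum.distrib)
qed

section \<open>Level \<open>2m\<close> is full\<close>

lemma list_of:
  assumes "finite A"
  obtains xs where "set xs = A" "distinct xs" "length xs = card A"
  using finite_distinct_list[OF assms] distinct_card by metis

lemma fin: "A \<subseteq> {1..n} \<Longrightarrow> finite A"
  by (rule finite_subset[OF _ finite_atLeastAtMost])

text \<open>Order \<open>insert p T\<close> with \<open>A\<close> first and \<open>p\<close> last,
  so that \<open>T\<close> is the \<open>2m\<close>-arc at 0. Counting consecutive present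
  \<open>m\<close>-arcs shows that both halves of \<open>T\<close> are present and that no other
  \<open>2m\<close>-arc is missing; the one-point swaps of \<open>T\<close> by \<open>p\<close> are
  these other arcs.\<close>

lemma missing_level:
  assumes T: "T \<subseteq> {1..n}" "card T = 2 * m" "T \<notin> \<F>" and p: "p \<in> {1..n} - T"
  shows "A \<subseteq> T \<Longrightarrow> card A = m \<Longrightarrow> A \<in> \<F>" and "t \<in> T \<Longrightarrow> insert p (T - {t}) \<in> \<F>"
proof -
  have both: "A \<in> \<F> \<and> (\<forall>t\<in>T. insert p (T - {t}) \<in> \<F>)" if A: "A \<subseteq> T" "card A = m" for A
  proof -
    have finT: "finite T" "finite A"
      using fin[OF T(1)] A(1) finite_subset by auto
    obtain as where as: "set as = A" "distinct as" "length as = card A"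
      using list_of[OF finT(2)] .
    obtain bs where bs: "set bs = T - A" "distinct bs" "length bs = card (T - A)"
      using list_of[of "T - A"] finT by blast
    have cb: "card (T - A) = m"
      using A T finT by (simp add: card_Diff_subset)
    define xs where "xs = as @ bs @ [p]"
    have xs: "distinct xs" "length xs = 2 * m + 1" "set xs \<subseteq> {1..n}" "set xs = insert p T"
      using as bs cb A T(1) p by (auto simp: xs_def)
    define h :: "nat \<Rightarrow> real" where "h i = of_bool (img xs i m \<in> \<F>)" for i
    define c :: "nat \<Rightarrow> real" where "c i = of_bool (img xs i (2 * m) \<notin> \<F>)" for i
    define e :: "nat \<Rightarrow> real" where "e i = of_bool (img xs i m \<in> \<F> \<and> img xs (i + m) m \<in> \<F>)" for i
    have img: "img xs i k = set (take k (drop i xs))" if "i + k \<le> 2 * m + 1" for i k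
      using image_nth_interval[of i "i + k" xs] that xs(2) by (simp add: arc_interval)
    have i0: "img xs 0 m = A"
      using as A by (subst img) (simp_all add: xs_def)
    have "img xs 0 (2 * m) = T"
      using as bs A cb by (subst img) (auto simp: xs_def)
    then have c0: "c 0 = 1"
      using T by (simp add: c_def)
    have ge0: "c i \<ge> 0" "e i \<ge> 0" for i
      by (simp_all add: c_def e_def)
    have split: "(\<Sum>i<2 * m + 1. g i) = g 0 + (\<Sum>i\<in>{1..<2 * m + 1}. g i)" for g :: "nat \<Rightarrow> real"
      using sum.atLeast_Suc_lessThan[of 0 "2 * m + 1" g] unfolding lessThan_atLeast0 One_nat_def by blast
    have c_split: "(\<Sum>i<2 * m + 1. c i) = 1 + (\<Sum>i\<in>{1..<2 * m + 1}. c i)"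
      unfolding split c0 ..
    have c1: "(\<Sum>i\<in>{1..<2 * m + 1}. c i) \<ge> 0"
      by (intro sum_nonneg ge0)
    have eq: "(\<Sum>i<2 * m + 1. h i) = real m * of_bool (set xs \<notin> \<F>) + (\<Sum>i<2 * m + 1. c i)"
      using cyc[OF xs(1-3)] unfolding h_def c_def .
    \<comment> \<open>Otherwise no \<open>m\<close>-arc is present, while \<open>T\<close> alone
      makes the right-hand side positive.\<close>
    have "set xs \<notin> \<F>"
    proof
      assume "set xs \<in> \<F>"
      then have "h i = 0" for i
        using big_notin[OF xs(1-3), of i] by (auto simp: h_def)
      then show False
        using eq c_split c1 \<open>set xs \<in> \<F>\<close> by simp
    qed
    then have eq: "(\<Sum>i<2 * m + 1. h i) = m + (\<Sum>i<2 * m + 1. c i)"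
      using eq by simp
    have ec: "e i \<le> c i" for i
      using img_free[OF xs(1,2), of m m i] by (auto simp: e_def c_def mult_2)
    have shift: "(\<Sum>i<2 * m + 1. h (i + m)) = (\<Sum>i<2 * m + 1. h i)"
      by (rule sum_shift) (simp_all add: h_def)
    have "(\<Sum>i<2 * m + 1. h i + h (i + m)) \<le> (\<Sum>i<2 * m + 1. 1 + e i)"
      by (intro sum_mono) (auto simp: h_def e_def)
    then have "2 * (\<Sum>i<2 * m + 1. h i) \<le> 2 * m + 1 + (\<Sum>i<2 * m + 1. e i)"
      using shift by (simp only: sum.distrib) simp
    then have 1: "2 * (\<Sum>i<2 * m + 1. c i) \<le> 1 + (\<Sum>i<2 * m + 1. e i)"
      using eq by simp
    have e_le: "(\<Sum>i<2 * m + 1. e i) \<le> e 0 + (\<Sum>i\<in>{1..<2 * m + 1}. c i)"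
      using sum_mono[of "{1..<2 * m + 1}" e c, OF ec]
      unfolding split by simp
    have "e 0 \<le> 1"
      by (simp add: e_def)
    \<comment> \<open>With \<open>x\<close> for this sum, the estimates give
      \<open>2 * (1 + x) \<le> 1 + e 0 + x\<close>, where \<open>e 0 \<le> 1\<close> and
      \<open>x \<ge> 0\<close>.\<close>
    then have "(\<Sum>i\<in>{1..<2 * m + 1}. c i) = 0" "e 0 = 1"
      using 1 e_le c_split c1 by auto
    have "\<forall>i\<in>{1..<2 * m + 1}. c i = 0"
      using \<open>(\<Sum>i\<in>{1..<2 * m + 1}. c i) = 0\<close> by (subst (asm) sum_nonneg_eq_0_iff) (use ge0 in auto)
    then have c_0: "c i = 0" if "i \<in> {1..<2 * m + 1}" for i
      using that by blast
    have "A \<in> \<F>"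
      using \<open>e 0 = 1\<close> unfolding e_def i0 by (auto split: if_splits)
    moreover have "insert p (T - {t}) \<in> \<F>" if t: "t \<in> T" for t
    proof -
      obtain j where j: "j < 2 * m + 1" "xs ! j = t"
        using t xs(2,4) by (metis in_set_conv_nth insertI2)
      have "j \<noteq> 2 * m"
        using j t p as bs cb A by (auto simp: xs_def nth_append)
      then have j1: "j + 1 \<in> {1..<2 * m + 1}"
        using j by auto
      have full: "img xs j 1 \<union> img xs (j + 1) (2 * m) = set xs" "img xs j 1 \<inter> img xs (j + 1) (2 * m) = {}"
        using img_Un[of xs j 1 "2 * m"] img_full[OF xs(2), of j] img_disjoint[OF xs(1,2), of 1 "2 * m" j]
        by (simp_all add: add.commute)
      have "img xs j 1 = {t}"
        using j by (simp add: arc_interval)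
      then have "img xs (j + 1) (2 * m) = insert p (T - {t})"
        using full xs(4) t p by auto
      then show ?thesis
        using c_0[OF j1] by (simp add: c_def)
    qed
    ultimately show ?thesis by blast
  qed
  show "A \<subseteq> T \<Longrightarrow> card A = m \<Longrightarrow> A \<in> \<F>"
    using both by blast
  obtain A where "A \<subseteq> T" "card A = m"
    using obtain_subset_with_card_n[of m T] T(2) by auto
  then show "t \<in> T \<Longrightarrow> insert p (T - {t}) \<in> \<F>"
    using both by blast
qed

text \<open>If \<open>T\<close> were missing, its \<open>m\<close>-subsets and one-point swaps would
  be present. \<open>exchange_arcs\<close> then gives a present \<open>m\<close>-set with one point
  outside \<open>T\<close> whose complement in such a swap is an \<open>m\<close>-subset of
  \<open>T\<close>, a forbidden partition.\<close>

lemma level_2m: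
  assumes T: "T \<subseteq> {1..n}" "card T = 2 * m"
  shows "T \<in> \<F>"
proof (rule ccontr)
  assume no: "T \<notin> \<F>"
  have finT: "finite T"
    using fin[OF T(1)] .
  have "card ({1..n} - T) = m"
    using T finT by (simp add: card_Diff_subset n)
  then obtain D where D: "D \<subseteq> {1..n} - T" "card D = 2"
    using obtain_subset_with_card_n[of 2 "{1..n} - T"] m by auto
  then obtain p z where "D = {p, z}" and pz0: "p \<noteq> z"
    by (meson card_2_iff)
  with D have pz: "p \<in> {1..n} - T" "z \<in> {1..n} - T" "p \<noteq> z"
    by auto
  have "T \<noteq> {}"
    using T(2) m by auto
  then obtain t where t: "t \<in> T" by blast
  have cTt: "card (T - {t}) = 2 * m - 1"
    using T(2) t finT by simp
  have "m \<le> card (T - {t})"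
    using cTt m by simp
  then obtain A where A: "A \<subseteq> T - {t}" "card A = m" "finite A"
    by (rule obtain_subset_with_card_n)
  have cR: "card (T - {t} - A) = m - 1"
    using A cTt m by (simp add: card_Diff_subset)
  obtain xs where xs: "set xs = A" "distinct xs" "length xs = card A"
    using list_of[OF A(3)] .
  obtain a as where as: "xs = a # as"
    using xs A m by (cases xs) auto
  obtain ys where ys: "set ys = T - {t} - A" "distinct ys" "length ys = card (T - {t} - A)"
    using list_of[of "T - {t} - A"] finT by blast
  obtain v ps where ps: "ys = v # ps"
    using ys cR m by (cases ys) auto
  have Tt: "T - {t} = insert a (set as) \<union> insert v (set ps)"
    using xs ys as ps A by auto
  have dist: "a \<notin> set as" "v \<notin> set ps" "a \<noteq> v" "a \<notin> set ps" "v \<notin> set as" "set as \<inter> set ps = {}"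
    "distinct as" "distinct ps"
    using xs ys unfolding as ps by auto
  have len: "length as = m - 1" "length ps = m - 2"
    using xs ys A cR unfolding as ps by auto
  have sub_T: "set as \<subseteq> T" "set ps \<subseteq> T" "a \<in> T" "v \<in> T"
    using Tt by auto
  have notin: "p \<notin> set as" "p \<notin> set ps" "p \<noteq> a" "p \<noteq> v" "z \<notin> set as" "z \<notin> set ps" "z \<noteq> a" "z \<noteq> v"
    using sub_T pz by auto
  have half: "X \<in> \<F>" if "X \<subseteq> T" "card X = m" for X
    using missing_level(1)[OF T no pz(1) that] .
  have c1: "card (set as) = m - 1" "card (set ps) = m - 2"
    using dist len distinct_card by fastforce+
  have "insert u (set as) \<in> \<F>" if "u \<in> T" "u \<notin> set as" for u
    using that c1 m sub_T by (intro half) auto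
  then have mem: "insert v (set as) \<in> \<F>" "insert a (set as) \<in> \<F>"
    using dist sub_T by auto
  have mem': "insert a (insert v (set ps)) \<in> \<F>"
    using dist sub_T c1 m by (intro half) auto
  have Tp: "insert p (T - {t}) \<in> \<F>" and Tz: "insert z (T - {t}) \<in> \<F>"
    using missing_level(2)[OF T no _ t] pz by auto
  have "insert p (set as) \<in> \<F> \<or> insert a (insert z (set ps)) \<in> \<F> \<or> {p, v} \<union> set ps \<in> \<F>"
  proof (rule exchange_arcs)
    show "distinct (a # as @ [p, v] @ ps @ [z])"
      using dist notin pz by auto
    show "set (a # as @ [p, v] @ ps @ [z]) \<subseteq> {1..n}"
      using sub_T T(1) pz by auto
    show "set (a # as) \<in> \<F>"
      using mem by simp
  qed (fact len)+
  then show False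
  proof (elim disjE)
    assume "insert p (set as) \<in> \<F>"
    moreover have "insert p (set as) \<union> insert a (insert v (set ps)) = insert p (T - {t})"
      unfolding Tt by auto
    moreover have "insert p (set as) \<inter> insert a (insert v (set ps)) = {}"
      using dist notin by auto
    ultimately show False
      using partition_freeD[OF pf _ mem'] Tp by metis
  next
    assume "insert a (insert z (set ps)) \<in> \<F>"
    moreover have "insert a (insert z (set ps)) \<union> insert v (set as) = insert z (T - {t})"
      unfolding Tt by auto
    moreover have "insert a (insert z (set ps)) \<inter> insert v (set as) = {}"
      using dist notin by auto
    ultimately show False
      using partition_freeD[OF pf _ mem(1)] Tz by metis
  next
    assume "{p, v} \<union> set ps \<in> \<F>"
    moreover have "({p, v} \<union> set ps) \<union> insert a (set as) = insert p (T - {t})"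
      unfolding Tt by auto
    moreover have "({p, v} \<union> set ps) \<inter> insert a (set as) = {}"
      using dist notin by auto
    ultimately show False
      using partition_freeD[OF pf _ mem(2)] Tp by metis
  qed
qed

section \<open>The present \<open>m\<close>-sets form a star\<close>

lemma intersecting:
  assumes "A \<in> \<F>" "B \<in> \<F>" "card A = m" "card B = m"
  shows "A \<inter> B \<noteq> {}"
proof
  assume d: "A \<inter> B = {}"
  have "A \<subseteq> {1..n}" "B \<subseteq> {1..n}"
    using assms sub by auto
  then have "A \<union> B \<in> \<F>"
    using assms d finite_member by (intro level_2m) (auto simp: card_Un_disjoint)
  then show False
    using partition_freeD[OF pf assms(1,2) d] by blast
qed

text \<open>List \<open>A\<close> with \<open>q\<close> in front, then \<open>u\<close>, a spare
  point \<open>v\<close> and the rest of \<open>P\<close>. The third outcome of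
  \<open>exchange_arcs\<close> is disjoint from \<open>A\<close>, hence impossible.\<close>

lemma exchange:
  assumes A: "A \<in> \<F>" "card A = m" and P: "P \<subseteq> {1..n}" "card P = m" and AP: "A \<inter> P = {q}"
    and u: "u \<in> {1..n} - A - P"
  shows "P \<in> \<F> \<or> insert u (A - {q}) \<in> \<F>"
proof -
  have AV: "A \<subseteq> {1..n}"
    using A(1) sub by auto
  have finA: "finite A" "finite P"
    using fin AV P by auto
  have q: "q \<in> A" "q \<in> P"
    using AP by auto
  \<comment> \<open>Room for the spare point: \<open>A\<close>, \<open>P\<close> and
    \<open>u\<close> cover at most \<open>2m\<close> of the \<open>3m\<close> points.\<close>
  have "card (A \<union> P \<union> {u}) \<le> card (A \<union> P) + 1"
    using card_Un_le[of "A \<union> P" "{u}"] by simp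
  moreover have "card (A \<union> P) + 1 = 2 * m"
    using card_Un_Int[OF finA] A P AP by simp
  ultimately have "card (A \<union> P \<union> {u}) < card {1..n}"
    using m n by simp
  then have "A \<union> P \<union> {u} \<noteq> {1..n}"
    by auto
  moreover have "A \<union> P \<union> {u} \<subseteq> {1..n}"
    using AV P u by auto
  ultimately have "\<exists>v. v \<in> {1..n} \<and> v \<notin> A \<union> P \<union> {u}"
    by blast
  then obtain v where v: "v \<in> {1..n}" "v \<notin> A" "v \<notin> P" "v \<noteq> u"
    by blast
  obtain as where as: "set as = A - {q}" "distinct as" "length as = card (A - {q})"
    using list_of[of "A - {q}"] finA by blast
  obtain ys where ys: "set ys = P - {q}" "distinct ys" "length ys = card (P - {q})"
    using list_of[of "P - {q}"] finA by blast
  have cA: "card (A - {q}) = m - 1" "card (P - {q}) = m - 1"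
    using A P q finA by auto
  have "length ys = m - 1"
    using ys(3) cA(2) by simp
  then have "ys \<noteq> []"
    using m by auto
  then obtain ps z where ps: "ys = ps @ [z]"
    using that[of "butlast ys" "last ys"] by simp
  have len: "length as = m - 1" "length ps = m - 2"
    using as ys cA unfolding ps by auto
  have sP: "insert z (set ps) = P - {q}" and zp: "z \<notin> set ps"
    using ys unfolding ps by auto
  have d: "(A - {q}) \<inter> (P - {q}) = {}"
    using AP by auto
  have "insert u (set as) \<in> \<F> \<or> insert q (insert z (set ps)) \<in> \<F> \<or> {u, v} \<union> set ps \<in> \<F>"
  proof (rule exchange_arcs)
    have psz: "set ps \<subseteq> P" "z \<in> P" "q \<notin> set ps" "q \<noteq> z" "set as \<subseteq> A" "q \<notin> set as"
      using sP as(1) by blast+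
    moreover have "set as \<inter> set ps = {}" "z \<notin> set as" "distinct ps"
      using psz d as(1) ys(2) unfolding ps by auto
    ultimately show "distinct (q # as @ [u, v] @ ps @ [z])"
      using as(2) u v q zp by auto
    show "set (q # as @ [u, v] @ ps @ [z]) \<subseteq> {1..n}"
      using AV P(1) u v(1) q(1) psz by auto
    show "set (q # as) \<in> \<F>"
      using A q as by (simp add: insert_absorb)
  qed (fact len)+
  moreover have "insert q (insert z (set ps)) = P"
    unfolding sP using q by auto
  moreover have "{u, v} \<union> set ps \<notin> \<F>"
  proof
    assume *: "{u, v} \<union> set ps \<in> \<F>"
    have sub_P: "set ps \<subseteq> P - {q}"
      using sP by auto
    have "card (set ps) = m - 2"
      using len ys(2) distinct_card[of ps] unfolding ps by simp
    moreover have "u \<notin> set ps" "v \<notin> set ps"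
      using sub_P u v by auto
    ultimately have "card ({u, v} \<union> set ps) = m"
      using v m by simp
    from intersecting[OF * A(1) this A(2)] show False
      using sub_P d u v q by auto
  qed
  ultimately show ?thesis
    unfolding as(1) by metis
qed

lemma star_or_empty:
  "{A \<in> \<F>. card A = m} = {} \<or> (\<exists>q\<in>{1..n}. {A \<in> \<F>. card A = m} = {A. A \<subseteq> {1..n} \<and> card A = m \<and> q \<in> A})"
proof (cases "{A \<in> \<F>. card A = m} = {}")
  case False
  have "\<exists>q\<in>{1..n}. {A \<in> \<F>. card A = m} = {A. A \<subseteq> {1..n} \<and> card A = m \<and> q \<in> A}"
  proof (rule star_of_exchange)
    show "finite {1..n}" "3 * m \<le> card {1..n} + 1" "2 \<le> m"
      using m n by simp_all
    show "E \<subseteq> {1..n} \<and> card E = m" if "E \<in> {A \<in> \<F>. card A = m}" for E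
      using that sub by blast
    show "E \<inter> P \<noteq> {}" if "E \<in> {A \<in> \<F>. card A = m}" "P \<in> {A \<in> \<F>. card A = m}" for E P
      using that intersecting by blast
    show "P \<in> {A \<in> \<F>. card A = m} \<or> insert u (E - {q}) \<in> {A \<in> \<F>. card A = m}"
      if E: "E \<in> {A \<in> \<F>. card A = m}" and P: "P \<subseteq> {1..n}" "card P = m" and EP: "E \<inter> P = {q}"
        and u: "u \<in> {1..n} - E - P" for E P q u
    proof -
      have E': "E \<in> \<F>" "card E = m"
        using E by auto
      have q: "q \<in> E"
        using EP by blast
      have "card (insert u (E - {q})) = card E"
        using card.remove[OF finite_member[OF E'(1)] q] finite_member[OF E'(1)] u by simp
      then show ?thesis
        using exchange[OF E' P EP u] P E' by simp
    qed
  qed (fact False)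
  then show ?thesis ..
qed simp

text \<open>Without a present \<open>m\<close>-subset the cyclic equation for a missing
  \<open>B\<close> would read 0 on the left and at least \<open>m\<close> on the right. Conversely,
  a present \<open>m\<close>-subset has a present complement in \<open>B\<close>.\<close>

lemma top_level:
  assumes B: "B \<subseteq> {1..n}" "card B = 2 * m + 1"
  shows "B \<notin> \<F> \<longleftrightarrow> (\<exists>A\<in>\<F>. A \<subseteq> B \<and> card A = m)"
proof
  assume no: "B \<notin> \<F>"
  show "\<exists>A\<in>\<F>. A \<subseteq> B \<and> card A = m"
  proof (rule ccontr)
    assume none: "\<not> ?thesis"
    obtain xs where xs: "set xs = B" "distinct xs" "length xs = card B"
      using list_of[OF fin[OF B(1)]] .
    then have l: "length xs = 2 * m + 1" and V: "set xs \<subseteq> {1..n}"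
      using B by auto
    have "img xs i m \<notin> \<F>" for i
      using none img_subset[OF l, of i m] img_card[OF xs(2) l, of m i] xs(1) by auto
    then have "0 = real m * of_bool (set xs \<notin> \<F>) + (\<Sum>i<2 * m + 1. of_bool (img xs i (2 * m) \<notin> \<F>))"
      using cyc[OF xs(2) l V] by (simp only: of_bool_eq(1) sum.neutral_const)
    moreover have "(\<Sum>i<2 * m + 1. of_bool (img xs i (2 * m) \<notin> \<F>)) \<ge> (0 :: real)"
      by (intro sum_nonneg) simp
    moreover have "real m * of_bool (set xs \<notin> \<F>) = real m" "real m > 0"
      using no m xs(1) by simp_all
    ultimately show False
      by linarith
  qed
next
  assume "\<exists>A\<in>\<F>. A \<subseteq> B \<and> card A = m"
  then obtain A where A: "A \<in> \<F>" "A \<subseteq> B" "card A = m"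
    by blast
  have "B - A \<in> \<F>"
    using A B finite_member[OF A(1)] by (intro next_level) (auto simp: card_Diff_subset)
  moreover have "A \<union> (B - A) = B"
    using A by blast
  ultimately show "B \<notin> \<F>"
    using partition_freeD[OF pf A(1), of "B - A"] by auto
qed

end

section \<open>Assembling the extremal families for \<open>n = 3m\<close>\<close>

context partition_free_family
begin

text \<open>The bound settles all levels except \<open>m\<close>, \<open>2m\<close> and
  \<open>2m + 1\<close>. The cyclic equation makes level \<open>2m\<close> full, level
  \<open>m\<close> empty or a star, and lets level \<open>m\<close> determine level
  \<open>2m + 1\<close>.\<close>

lemma extremal_3m:
  assumes n: "n = 3 * m" and m: "m \<ge> 6"
    and eq: "card \<F> = (\<Sum>t = m + 1..2 * m + 1. n choose t)"
  shows "\<F> = K_family (3 * m) \<or> (\<exists>q\<in>{1..n}. \<F> = K_tilde m q)"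
proof -
  have mid: "f t = 1" if "m + 1 \<le> t" "t \<le> 2 * m - 1" for t
    using bound_3m(2)[OF n m eq, of "2 * m - 1 - t"] that m by simp
  have low: "f t = 0" if "t \<le> m - 1" for t
    using bound_3m(2)[OF n m eq, of t] bound_3m(3)[OF n m eq] that by (cases "t = m - 1") auto
  have high: "f t = 0" if "t \<ge> 2 * m + 2" "t \<le> n" for t
    using bound_3m(2)[OF n m eq, of "3 * m - t"] that n by auto
  \<comment> \<open>The last equation of \<open>bound_3m\<close> is equality in
    \<open>dens_cycle\<close> once the known densities are inserted.\<close>
  have cyc_eq: "m * f (2 * m + 1) + real (2 * m + 1) * (f m + f (m - 1) + f (2 * m) + f (m + 1) + f (m + 2) + f (2 * m - 1))
      = real (m + 4 * (2 * m + 1))"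
  proof -
    have 1: "f (m - 1) = 0" "f (m + 1) = 1" "f (m + 2) = 1" "f (2 * m - 1) = 1"
      using low[of "m - 1"] mid[of "m + 1"] mid[of "m + 2"] mid[of "2 * m - 1"] m by auto
    show ?thesis
      using bound_3m(4)[OF n m eq] unfolding 1 by (simp add: algebra_simps)
  qed
  interpret cyclic_extremal n \<F> m
  proof
    show "A \<in> \<F>" if "A \<subseteq> {1..n}" "card A = m + 1" for A
      using level_full[OF mid[of "m + 1"] that] m by simp
    fix xs assume xs: "distinct xs" "length xs = 2 * m + 1" "set xs \<subseteq> {1..n}"
    let ?N = "2 * m + 1"
    have inj: "inj_on ((!) xs) {..<?N}"
      using xs by (intro inj_on_nth) auto
    have full: "(!) xs ` {..<?N} = set xs"
      using nth_image[of ?N xs] xs(2) by (simp add: lessThan_atLeast0)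
    have arc_V: "arc ?N i k \<subseteq> {..<?N}" for i k
      by (rule arc_subset) simp
    have img_V: "(!) xs ` X \<subseteq> {1..n}" if "X \<subseteq> {..<?N}" for X
      using image_mono[OF that, of "(!) xs"] full xs(3) by auto
    have cimg: "card ((!) xs ` X) = card X" if "X \<subseteq> {..<?N}" for X
      using inj_on_subset[OF inj that] by (rule card_image)
    have full_img: "(!) xs ` X \<in> \<F>" if "X \<subseteq> {..<?N}" "m + 1 \<le> card X" "card X \<le> 2 * m - 1" for X
      using level_full[OF mid[OF that(2,3)] img_V[OF that(1)] cimg[OF that(1)]] .
    have 1: "(!) xs ` arc ?N i (m + 1) \<in> \<F>" "(!) xs ` arc ?N i (m + 2) \<in> \<F>" for i
      using m by (intro full_img arc_V; simp add: card_arc)+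
    have 2: "(!) xs ` (arc ?N i (m - 1) \<union> arc ?N (i + m) m) \<in> \<F>" for i
    proof (rule full_img)
      show "arc ?N i (m - 1) \<union> arc ?N (i + m) m \<subseteq> {..<?N}"
        using arc_V by blast
      have "card (arc ?N i (m - 1) \<union> arc ?N (i + m) m) = 2 * m - 1"
        using m by (intro card_cycle_union) auto
      then show "m + 1 \<le> card (arc ?N i (m - 1) \<union> arc ?N (i + m) m)"
        "card (arc ?N i (m - 1) \<union> arc ?N (i + m) m) \<le> 2 * m - 1"
        using m by auto
    qed
    have 3: "(!) xs ` arc ?N i (m - 1) \<notin> \<F>" for i
      using level_empty[OF low[OF order_refl]] cimg[OF arc_V] card_arc[of "m - 1" ?N i] by fastforce
    have "real m * of_bool (set xs \<in> \<F>) + (\<Sum>i<?N. of_bool ((!) xs ` arc ?N i m \<in> \<F>) + 0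
        + of_bool ((!) xs ` arc ?N i (2 * m) \<in> \<F>) + 1 + 1 + 1) = real (m + 4 * ?N)"
    proof -
      have "1 \<le> m" "?N \<le> n" "(!) xs ` {..<?N} \<subseteq> {1..n}"
        using m n img_V[OF order_refl] by auto
      from local_cycle_eq[OF this(1,2) cyc_eq inj this(3)] show ?thesis
        unfolding full by (simp only: 1 2 3 of_bool_eq simp_thms)
    qed
    moreover have "(\<Sum>i<?N. of_bool ((!) xs ` arc ?N i (2 * m) \<notin> \<F>)) =
        (\<Sum>i<?N. 1 - of_bool ((!) xs ` arc ?N i (2 * m) \<in> \<F>) :: real)"
      by (intro sum.cong) auto
    moreover have "of_bool (set xs \<notin> \<F>) = (1 :: real) - of_bool (set xs \<in> \<F>)"
      by simp
    ultimately show "(\<Sum>i<?N. of_bool ((!) xs ` arc ?N i m \<in> \<F>)) =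
        real m * of_bool (set xs \<notin> \<F>) + (\<Sum>i<?N. of_bool ((!) xs ` arc ?N i (2 * m) \<notin> \<F>))"
      by (simp only: sum.distrib sum_subtractf) (simp add: algebra_simps)
  qed (use n m in auto)
  have mem: "A \<in> \<F> \<longleftrightarrow> card A = m \<and> A \<in> \<F> \<or> m + 1 \<le> card A \<and> card A \<le> 2 * m \<or>
      card A = 2 * m + 1 \<and> (\<forall>B\<in>\<F>. card B = m \<longrightarrow> \<not> B \<subseteq> A)" if A: "A \<subseteq> {1..n}" for A
  proof -
    have "card A \<le> n"
      using card_mono[OF _ A] by simp
    then consider "card A \<le> m - 1" | "card A = m" | "m + 1 \<le> card A" "card A \<le> 2 * m - 1"
      | "card A = 2 * m" | "card A = 2 * m + 1" | "2 * m + 2 \<le> card A" "card A \<le> n"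
      by linarith
    then show ?thesis
    proof cases
      case 1
      then show ?thesis using level_empty[OF low[OF 1]] m by auto
    next
      case 2
      then show ?thesis by simp
    next
      case 3
      then have "A \<in> \<F>" using level_full[OF mid[OF 3] A] by blast
      moreover have "card A \<le> 2 * m" using 3(2) by linarith
      ultimately show ?thesis using 3(1) by blast
    next
      case 4
      then have "A \<in> \<F>" using level_2m[OF A] by blast
      moreover have "m + 1 \<le> card A" "card A \<le> 2 * m" using 4 m by linarith+
      ultimately show ?thesis by blast
    next
      case 5
      have "A \<in> \<F> \<longleftrightarrow> (\<forall>B\<in>\<F>. card B = m \<longrightarrow> \<not> B \<subseteq> A)"
        using top_level[OF A 5] by blast
      moreover have "card A \<noteq> m" "\<not> card A \<le> 2 * m" using 5 m by linarith+
      ultimately show ?thesis using 5 by blast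
    next
      case 6
      then show ?thesis using level_empty[OF high[OF 6]] by auto
    qed
  qed
  have K: "K_family (3 * m) = {A. A \<subseteq> {1..n} \<and> m + 1 \<le> card A \<and> card A \<le> 2 * m + 1}"
    unfolding K_family_def n by simp
  have Kt: "K_tilde m q = {A. A \<subseteq> {1..n} \<and> card A = m \<and> q \<in> A} \<union>
      ({A. A \<subseteq> {1..n} \<and> m + 1 \<le> card A \<and> card A \<le> 2 * m + 1} -
       {A. A \<subseteq> {1..n} \<and> card A = 2 * m + 1 \<and> q \<in> A})" for q
    unfolding K_tilde_def K by (simp only: n)
  show ?thesis
    using star_or_empty
  proof
    assume "{A \<in> \<F>. card A = m} = {}"
    then have none: "card A \<noteq> m" if "A \<in> \<F>" for A
      using that by blast
    have "A \<in> \<F> \<longleftrightarrow> A \<in> K_family (3 * m)" for A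
    proof (cases "A \<subseteq> {1..n}")
      case True
      have "A \<in> \<F> \<longleftrightarrow> m + 1 \<le> card A \<and> card A \<le> 2 * m \<or> card A = 2 * m + 1"
        using mem[OF True] none by blast
      then show ?thesis
        unfolding K using True by auto
    qed (use sub K in auto)
    then show ?thesis by blast
  next
    assume "\<exists>q\<in>{1..n}. {A \<in> \<F>. card A = m} = {A. A \<subseteq> {1..n} \<and> card A = m \<and> q \<in> A}"
    then obtain q where q: "q \<in> {1..n}" and "{A \<in> \<F>. card A = m} = {A. A \<subseteq> {1..n} \<and> card A = m \<and> q \<in> A}"
      by blast
    then have star: "A \<in> \<F> \<longleftrightarrow> q \<in> A" if "A \<subseteq> {1..n}" "card A = m" for A
      using that by blast
    have top: "(\<forall>B\<in>\<F>. card B = m \<longrightarrow> \<not> B \<subseteq> A) \<longleftrightarrow> q \<notin> A" if A: "A \<subseteq> {1..n}" "card A = 2 * m + 1" for A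
    proof
      assume *: "\<forall>B\<in>\<F>. card B = m \<longrightarrow> \<not> B \<subseteq> A"
      show "q \<notin> A"
      proof
        assume qA: "q \<in> A"
        have "m - 1 \<le> card (A - {q})"
          using A qA fin[OF A(1)] by simp
        then obtain R where R: "R \<subseteq> A - {q}" "card R = m - 1" "finite R"
          by (rule obtain_subset_with_card_n)
        have "card (insert q R) = m"
          using R m by (subst card_insert_disjoint) auto
        moreover have "insert q R \<subseteq> A"
          using R qA by auto
        moreover have "insert q R \<in> \<F>"
          using star[of "insert q R"] calculation A(1) by blast
        ultimately show False
          using * by blast
      qed
    next
      assume "q \<notin> A"
      then show "\<forall>B\<in>\<F>. card B = m \<longrightarrow> \<not> B \<subseteq> A"
        using star A by blast
    qed
    have "A \<in> \<F> \<longleftrightarrow> A \<in> K_tilde m q" for A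
    proof (cases "A \<subseteq> {1..n}")
      case True
      have "A \<in> \<F> \<longleftrightarrow> card A = m \<and> q \<in> A \<or> m + 1 \<le> card A \<and> card A \<le> 2 * m \<or> card A = 2 * m + 1 \<and> q \<notin> A"
        using mem[OF True] star[OF True] top[OF True] by blast
      then show ?thesis
        unfolding Kt using True by auto
    next
      case False
      then show ?thesis
        unfolding Kt using sub by auto
    qed
    then show ?thesis
      using q by blast
  qed
qed

end

theorem theorem2:
  fixes m n :: nat and \<F> :: "nat set set"
  assumes "m \<ge> 6"
    and "n = 3 * m + 2 \<or> n = 3 * m"
    and "\<F> \<subseteq> Pow {1..n}"
    and "partition_free \<F>"
  shows "card \<F> \<le> (\<Sum>t = m + 1..2 * m + 1. n choose t) \<and>
    (n = 3 * m + 2 \<longrightarrow> card \<F> = (\<Sum>t = m + 1..2 * m + 1. n choose t) \<longrightarrow>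
       (\<exists>\<pi>. \<pi> permutes {1..n} \<and>
          ((`) \<pi> ` \<F> = K_family (3 * m + 2) \<or>
           (`) \<pi> ` \<F> = double_family (3 * m + 1) (K_family (3 * m + 1))))) \<and>
    (n = 3 * m \<longrightarrow> card \<F> = (\<Sum>t = m + 1..2 * m + 1. n choose t) \<longrightarrow>
       (\<F> = K_family (3 * m) \<or> (\<exists>x\<in>{1..n}. \<F> = K_tilde m x)))"
proof -
  interpret partition_free_family n \<F>
    by unfold_locales (use assms(3,4) in auto)
  show ?thesis
  proof (cases "n = 3 * m")
    case True
    show ?thesis
    proof (intro conjI impI)
      show "card \<F> \<le> (\<Sum>t = m + 1..2 * m + 1. n choose t)"
        by (rule bound_3m(1)[OF True assms(1)])
    next
      assume "n = 3 * m + 2"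
      then show "\<exists>\<pi>. \<pi> permutes {1..n} \<and> ((`) \<pi> ` \<F> = K_family (3 * m + 2) \<or>
          (`) \<pi> ` \<F> = double_family (3 * m + 1) (K_family (3 * m + 1)))"
        using True by linarith
    next
      assume "card \<F> = (\<Sum>t = m + 1..2 * m + 1. n choose t)"
      then show "\<F> = K_family (3 * m) \<or> (\<exists>x\<in>{1..n}. \<F> = K_tilde m x)"
        by (rule extremal_3m[OF True assms(1)])
    qed
  next
    case False
    then have n: "n = 3 * m + 2"
      using assms(2) by blast
    have "\<exists>\<pi>. \<pi> permutes {1..n} \<and> ((`) \<pi> ` \<F> = K_family (3 * m + 2) \<or>
        (`) \<pi> ` \<F> = double_family (3 * m + 1) (K_family (3 * m + 1)))"
      if eq: "card \<F> = (\<Sum>t = m + 1..2 * m + 1. n choose t)"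
      using extremal_3m2[OF n assms(1) eq]
    proof
      assume "\<F> = K_family (3 * m + 2)"
      then have "id permutes {1..n} \<and> (`) id ` \<F> = K_family (3 * m + 2)"
        by (simp add: permutes_id)
      then show ?thesis by blast
    next
      assume "\<exists>q\<in>{1..n}. \<F> = {A. A \<subseteq> {1..n} \<and> m + 1 \<le> card (A - {q}) \<and> card (A - {q}) \<le> 2 * m + 1}"
      then obtain q where q: "q \<in> {1..3 * m + 2}"
        and F: "\<F> = {A. A \<subseteq> {1..3 * m + 2} \<and> m + 1 \<le> card (A - {q}) \<and> card (A - {q}) \<le> 2 * m + 1}"
        unfolding n by (elim bexE)
      show ?thesis
        using image_double_family[OF q F] unfolding n by blast
    qed
    then show ?thesis
      using bound_3m2(1)[OF n assms(1)] False by (intro conjI impI) blast+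
  qed
qed

end
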